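(* For every integer $N\ge 2$ there exists a simple avoidance coupling of $\lceil N/4\rceil$ walks on the complete graph $K_N$.
   Context: For a positive integer $n$ write $[n]=\{1,\dots,n\}$. $K_n$ denotes the complete graph (without loops) on vertex set $[n]$. A simple random walk on a graph $G$ with vertex set $[n]$ is a Markov chain $(X_t)_{t\in\mathbb{Z}}$ (indexed by all integers) of elements of $[n]$ such that for all $t\in\mathbb{Z}$, given the past, $X_t$ is uniformly distributed on the neighbors of $X_{t-1}$. Explicitly: for every $t\in\mathbb{Z}$, every $\ell\ge 1$, every history $w_{t-\ell},\dots,w_{t-1}\in[n]$ with $\mathbb{P}(X_{t-1}=w_{t-1},\dots,X_{t-\ell}=w_{t-\ell})>0$ and every neighbor $v$ of $w_{t-1}$, $$\mathbb{P}(X_t=v\mid X_{t-1}=w_{t-1},\dots,X_{t-\ell}=w_{t-\ell})=\frac{1}{\deg(w_{t-1})}.$$ (On $K_n$, this means conditional probability $\frac1{n-1}$ for every $v\ne w_{t-1}$.) A simple avoidance coupling (SAC) of $k$ walks on a graph $G$ with vertex set $[n]$ is a sequence $(U_t)_{t\in\mathbb{Z}}$ of random maps $U_t:[k]\to[n]$, all defined on a common probability space, such that: (1) for every $i\in[k]$, $(U_t(i))_{t\in\mathbb{Z}}$ is a simple random walk on $G$; (2) for every $t\in\mathbb{Z}$ and all $1\le i<j\le k$, $\mathbb{P}(U_t(i)=U_t(j))=\mathbb{P}(U_t(i)=U_{t-1}(j))=0$. (No independence between different walks is required. The walkers take turns in the order $1,\dots,k$ in each round.) The existence of a SAC means that some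 probability space carries such a sequence. *)

theory Defs
  imports "HOL-Probability.Probability"
begin

text \<open>Simple graphs on the vertex set \<open>{1..n}\<close> are given by their edge sets,
  which are sets of two-element subsets of \<open>{1..n}\<close>.\<close>

definition complete_graph :: "nat \<Rightarrow> nat set set" where
  "complete_graph n = {{u, v} | u v. u \<in> {1..n} \<and> v \<in> {1..n} \<and> u \<noteq> v}"

definition simple_graph :: "nat \<Rightarrow> nat set set \<Rightarrow> bool" where
  "simple_graph n E \<longleftrightarrow> E \<subseteq> complete_graph n"

definition neighbors :: "nat set set \<Rightarrow> nat \<Rightarrow> nat set" where
  "neighbors E u = {v. {u, v} \<in> E}"

definition vertex_degree :: "nat set set \<Rightarrow> nat \<Rightarrow> nat" where
  "vertex_degree E u = card (neighbors E u)"

text \<open>A history of length \<open>l\<close> before time \<open>t\<close> is given by the values of \<open>w\<close> on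
  \<open>{t - l..t - 1}\<close>; the other values of \<open>w\<close> play no role.\<close>

definition simple_random_walk ::
    "'a measure \<Rightarrow> nat \<Rightarrow> nat set set \<Rightarrow> (int \<Rightarrow> 'a \<Rightarrow> nat) \<Rightarrow> bool" where
  "simple_random_walk M n E X \<longleftrightarrow>
     prob_space M \<and> simple_graph n E \<and>
     (\<forall>t. X t \<in> measurable M (count_space {1..n})) \<and>
     (\<forall>(t::int) (l::nat) (w::int \<Rightarrow> nat) v.
        1 \<le> l \<longrightarrow>
        (\<forall>s\<in>{t - int l..t - 1}. w s \<in> {1..n}) \<longrightarrow>
        \<P>(\<omega> in M. \<forall>s\<in>{t - int l..t - 1}. X s \<omega> = w s) > 0 \<longrightarrow>
        v \<in> neighbors E (w (t - 1)) \<longrightarrow>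
        \<P>(\<omega> in M. X t \<omega> = v \<bar> \<forall>s\<in>{t - int l..t - 1}. X s \<omega> = w s)
          = 1 / real (vertex_degree E (w (t - 1))))"

text \<open>The random map at time \<open>t\<close> is \<open>\<lambda>\<omega>. U t \<omega>\<close>; only its values on \<open>{1..k}\<close> matter.
  Its measurability, coordinate by coordinate, and the fact that its values lie in
  \<open>{1..n}\<close> are part of the first condition (no walk is involved if \<open>k = 0\<close>).\<close>

definition simple_avoidance_coupling ::
    "'a measure \<Rightarrow> nat \<Rightarrow> nat set set \<Rightarrow> nat \<Rightarrow> (int \<Rightarrow> 'a \<Rightarrow> nat \<Rightarrow> nat) \<Rightarrow> bool" where
  "simple_avoidance_coupling M n E k U \<longleftrightarrow>
     prob_space M \<and> simple_graph n E \<and>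
     (\<forall>i\<in>{1..k}. simple_random_walk M n E (\<lambda>t \<omega>. U t \<omega> i)) \<and>
     (\<forall>t i j. 1 \<le> i \<and> i < j \<and> j \<le> k \<longrightarrow>
        \<P>(\<omega> in M. U t \<omega> i = U t \<omega> j) = 0 \<and>
        \<P>(\<omega> in M. U t \<omega> i = U (t - 1) \<omega> j) = 0)"

text \<open>HOL cannot quantify existentially over the type of the sample space. The next fact
  shows that nothing is lost by taking the sample points to be the trajectories
  \<open>int \<Rightarrow> nat \<Rightarrow> nat\<close>: a coupling on any probability space yields one on such a space.\<close>

lemma simple_avoidance_coupling_on_trajectories:
  fixes M :: "'a measure"
  assumes sac: "simple_avoidance_coupling M n E k U"
  shows "\<exists>(M' :: (int \<Rightarrow> nat \<Rightarrow> nat) measure) U'. simple_avoidance_coupling M' n E k U'"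
proof -
  interpret prob_space M using sac by (simp add: simple_avoidance_coupling_def)
  define F where "F \<omega> = (\<lambda>t i. U t \<omega> i)" for \<omega>
  define R where "R = sigma (F ` space M) {A. A \<subseteq> F ` space M \<and> F -` A \<inter> space M \<in> sets M}"
  have sa: "sigma_algebra (F ` space M) {A. A \<subseteq> F ` space M \<and> F -` A \<inter> space M \<in> sets M}"
  proof (rule sigma_algebra_iff2[THEN iffD2], safe)
    fix A assume "F -` A \<inter> space M \<in> sets M"
    moreover have "F -` (F ` space M - A) \<inter> space M = space M - (F -` A \<inter> space M)" by auto
    ultimately show "F -` (F ` space M - A) \<inter> space M \<in> sets M" by simp
  next
    fix A :: "nat \<Rightarrow> _ set"
    assume "range A \<subseteq> {A. A \<subseteq> F ` space M \<and> F -` A \<inter> space M \<in> sets M}"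
    then have "(\<Union>i. F -` A i \<inter> space M) \<in> sets M" by (intro sets.countable_UN) auto
    moreover have "F -` (\<Union>i. A i) \<inter> space M = (\<Union>i. F -` A i \<inter> space M)" by auto
    ultimately show "F -` \<Union> (range A) \<inter> space M \<in> sets M" by simp
  qed (use sigma_algebra_iff2 in auto)
  have spR: "space R = F ` space M" unfolding R_def by (rule space_measure_of) auto
  have setsR: "sets R = {A. A \<subseteq> F ` space M \<and> F -` A \<inter> space M \<in> sets M}"
    unfolding R_def using sigma_algebra.sets_measure_of_eq[OF sa] by simp
  have F: "F \<in> measurable M R"
    by (rule measurableI) (auto simp: spR setsR)
  define M' where "M' = distr M R F"
  have spM': "space M' = F ` space M" by (simp add: M'_def spR)
  have ps: "prob_space M'" unfolding M'_def by (rule prob_space_distr[OF F])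
  have pr: "\<P>(x in M'. P x) = \<P>(\<omega> in M. P (F \<omega>))"
    if "{\<omega>\<in>space M. P (F \<omega>)} \<in> sets M" for P
  proof -
    have eq: "F -` {x \<in> F ` space M. P x} \<inter> space M = {\<omega>\<in>space M. P (F \<omega>)}" by auto
    have "{x \<in> F ` space M. P x} \<in> sets R" using that unfolding setsR mem_Collect_eq eq by blast
    then show ?thesis
      unfolding spM' unfolding M'_def by (simp only: measure_distr[OF F] eq)
  qed
  define V where "V t x = (x t :: nat \<Rightarrow> nat)" for t :: int and x
  have VF: "V t (F \<omega>) = U t \<omega>" for t \<omega> by (simp add: V_def F_def)
  have mU: "(\<lambda>\<omega>. U t \<omega> i) \<in> measurable M (count_space {1..n})" if "i \<in> {1..k}" for t i
    using sac that by (auto simp: simple_avoidance_coupling_def simple_random_walk_def)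
  have mU': "(\<lambda>\<omega>. U t \<omega> i) \<in> measurable M (count_space UNIV)" if "i \<in> {1..k}" for t i
    using mU[OF that, of t] by (rule measurable_compose) simp
  have walk: "simple_random_walk M' n E (\<lambda>t x. V t x i)" if i: "i \<in> {1..k}" for i
  proof -
    have w: "simple_random_walk M n E (\<lambda>t \<omega>. U t \<omega> i)"
      using sac i by (auto simp: simple_avoidance_coupling_def)
    note [measurable] = mU'[OF i]
    have mV: "(\<lambda>x. V t x i) \<in> measurable M' (count_space {1..n})" for t
    proof (rule measurableI)
      fix x assume "x \<in> space M'"
      then show "V t x i \<in> space (count_space {1..n})"
        using measurable_space[OF mU[OF i, of t]] by (auto simp: spM' VF)
    next
      fix A assume "A \<in> sets (count_space {1..n})"
      then have "(\<lambda>\<omega>. U t \<omega> i) -` A \<inter> space M \<in> sets M"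
        by (rule measurable_sets[OF mU[OF i]])
      moreover have "F -` ((\<lambda>x. V t x i) -` A \<inter> F ` space M) \<inter> space M
          = (\<lambda>\<omega>. U t \<omega> i) -` A \<inter> space M" by (auto simp flip: VF)
      ultimately show "(\<lambda>x. V t x i) -` A \<inter> space M' \<in> sets M'"
        unfolding spM' unfolding M'_def sets_distr setsR mem_Collect_eq by simp
    qed
    have p1: "\<P>(x in M'. \<forall>s\<in>{a..b}. V s x i = w s)
        = \<P>(\<omega> in M. \<forall>s\<in>{a..b}. U s \<omega> i = w s)" for a b :: int and w
      by (subst pr) (simp_all add: VF)
    have p2: "\<P>(x in M'. V t x i = v \<and> (\<forall>s\<in>{a..b}. V s x i = w s))
        = \<P>(\<omega> in M. U t \<omega> i = v \<and> (\<forall>s\<in>{a..b}. U s \<omega> i = w s))" for t v and a b :: int and w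
      by (subst pr) (simp_all add: VF)
    show ?thesis
      using w ps mV unfolding simple_random_walk_def cond_prob_def p1 p2 by blast
  qed
  have "\<P>(x in M'. V t x i = V s x j) = \<P>(\<omega> in M. U t \<omega> i = U s \<omega> j)"
    if "1 \<le> i" "i < j" "j \<le> k" for t s i j
  proof -
    have [measurable]: "(\<lambda>\<omega>. U t \<omega> i) \<in> measurable M (count_space UNIV)"
      "(\<lambda>\<omega>. U s \<omega> j) \<in> measurable M (count_space UNIV)"
      using that by (auto intro!: mU')
    have "Measurable.pred M (\<lambda>\<omega>. \<exists>m. U t \<omega> i = m \<and> U s \<omega> j = m)" by measurable
    then have "{\<omega>\<in>space M. U t \<omega> i = U s \<omega> j} \<in> sets M" by (simp add: pred_def eq_commute)
    then show ?thesis by (subst pr) (simp_all add: VF)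
  qed
  with walk ps sac have "simple_avoidance_coupling M' n E k V"
    by (simp add: simple_avoidance_coupling_def)
  then show ?thesis by blast
qed

end

theory Submission
  imports Defs
begin

text \<open>
  Choose \<open>d\<close> with \<open>n = 2 ^ (d + 1) \<le> N < 2 * n\<close>. Then \<open>\<lceil>N / 4\<rceil> \<le> 2 ^ d\<close>, so it suffices to
  couple \<open>2 ^ d\<close> walks. Two constructions are superposed: a coupling on \<open>n\<close> vertices, and a
  random relabelling that transports it to \<open>N\<close> vertices.

  \<^emph>\<open>The walks on \<open>n\<close> vertices.\<close> Positions are numbers below \<open>n\<close>, added by XOR, so that a
  simple random walk is a walk with independent uniform nonzero jumps. Call the position of the
  leading bit of a jump its level. In each round one level \<open>J\<close> is drawn for all walkers
  together, with probability proportional to \<open>2 ^ J\<close>, and everybody jumps at that level. The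
  jumps of level \<open>J\<close> are taken from one sequence \<open>D\<^sub>1, D\<^sub>2, \<dots>\<close> of independent uniform numbers of
  level \<open>J\<close>: when level \<open>J\<close> is drawn for the \<open>k\<close>-th time, the walkers whose label has bit \<open>J\<close>
  unset jump by \<open>D\<^sub>k\<close>, the others by \<open>D\<^bsub>k+1\<^esub>\<close>. A single walker uses every
  term of each sequence at most once, so its jumps are independent and it performs a simple
  random walk. Between different walkers the delay by one term keeps the separation under
  control: with \<open>D J\<close> the next pending jump of level \<open>J\<close>, the positions of the walkers labelled
  \<open>a\<close> and \<open>b\<close> always differ by the XOR of the numbers \<open>D J XOR 1\<close> over the bits \<open>J\<close> in which \<open>a\<close>
  and \<open>b\<close> differ. The labels are the even numbers below \<open>n\<close>, in the order in which the
  walkers move. If \<open>m \<ge> 1\<close> is the highest differing bit, the separation has level \<open>m\<close>, so only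
  a jump of level \<open>m\<close> could take the earlier walker onto the later one; and that jump is
  \<open>D m\<close>, which misses the separation because of the extra XOR with 1 (\<open>offset_avoids\<close>).

  \<^emph>\<open>Passing to \<open>N\<close> vertices.\<close> Let \<open>\<sigma>\<close> be a permutation of the numbers below \<open>N\<close>, and
  show the walker at \<open>y < n\<close> at the vertex \<open>\<sigma> y\<close>; the vertices \<open>\<sigma> y\<close> with \<open>y \<ge> n\<close> are vacant.
  With each round \<open>\<sigma>\<close> is composed with a random involution \<open>relabel\<close> that swaps each pair
  \<open>y < n \<le> h\<close> with probability \<open>1 / (N - 1)\<close>. This never creates a collision, since a vertex
  in use either keeps its meaning or becomes vacant. A walker jumping to a
  uniform \<open>y\<close> among the \<open>n - 1\<close> other positions then lands on each of the \<open>N - n\<close> vacant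
  vertices with probability \<open>1 / (N - 1)\<close>, and by symmetry on each of the remaining \<open>n - 1\<close>
  vertices with the same probability (\<open>card_relabel_to\<close>).

  \<^emph>\<open>Two-sided time.\<close> To keep the state finite, only the pending jumps are stored, and a used
  jump is replaced by its XOR with fresh noise. Then every value of the noise acts as a
  bijection of the finite state space. Starting at time 0 from a uniform state, with independent
  noise at all integer times, the process can be run forwards and, with the inverse bijections,
  backwards; its state at any given time is uniform and independent of the noise. Hence the law
  of a walk in any time window is a matter of counting: the number of pairs of a state and a
  noise word that produce a given path must be multiplied by a constant factor for each further
  step (\<open>prob_path\<close>, \<open>walk_if_path_counts_geometric\<close>, \<open>sum_path_count\<close>).
\<close>

section \<open>Stationary processes driven by random bijections\<close>

primrec readout :: "('x \<Rightarrow> 's \<Rightarrow> 's) \<Rightarrow> ('s \<Rightarrow> 'v) \<Rightarrow> 's \<Rightarrow> 'x list \<Rightarrow> 'v list" where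
  "readout F V s [] = []"
| "readout F V s (x # xs) = V (F x s) # readout F V (F x s) xs"

lemma length_readout [simp]: "length (readout F V s xs) = length xs"
  by (induction xs arbitrary: s) auto

locale noise_driven =
  fixes S :: "'s set" and \<Xi> :: "'x set" and F :: "'x \<Rightarrow> 's \<Rightarrow> 's"
  assumes fin_S: "finite S" and S_ne: "S \<noteq> {}"
    and fin_\<Xi>: "finite \<Xi>" and \<Xi>_ne: "\<Xi> \<noteq> {}"
    and bij_F: "x \<in> \<Xi> \<Longrightarrow> bij_betw (F x) S S"
begin

text \<open>A word acts from the state \<open>s\<close> on, so \<open>ws\<close> starts with the value of \<open>V\<close> one step after
  \<open>s\<close>, not with \<open>V s\<close>.\<close>

definition noise_words :: "'v list \<Rightarrow> ('s \<Rightarrow> 'v) \<Rightarrow> 's \<Rightarrow> 'x list set" where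
  "noise_words ws V s = {xs. set xs \<subseteq> \<Xi> \<and> readout F V s xs = ws}"

lemma finite_noise_words: "finite (noise_words ws V s)"
proof (rule finite_subset)
  show "noise_words ws V s \<subseteq> {xs. set xs \<subseteq> \<Xi> \<and> length xs = length ws}"
    by (auto simp: noise_words_def)
qed (rule finite_lists_length_eq[OF fin_\<Xi>])

lemma noise_words_Nil [simp]: "noise_words [] V s = {[]}"
proof (rule set_eqI)
  show "xs \<in> noise_words [] V s \<longleftrightarrow> xs \<in> {[]}" for xs
    by (cases xs) (auto simp: noise_words_def)
qed

lemma card_noise_words_Cons:
  "card (noise_words (w # ws) V s)
     = (\<Sum>x\<in>\<Xi>. if V (F x s) = w then card (noise_words ws V (F x s)) else 0)"
proof -
  have "noise_words (w # ws) V s = (\<Union>x\<in>{x\<in>\<Xi>. V (F x s) = w}. (#) x ` noise_words ws V (F x s))"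
  proof (rule set_eqI)
    show "xs \<in> noise_words (w # ws) V s
        \<longleftrightarrow> xs \<in> (\<Union>x\<in>{x\<in>\<Xi>. V (F x s) = w}. (#) x ` noise_words ws V (F x s))" for xs
      by (cases xs) (auto simp: noise_words_def)
  qed
  also have "card \<dots> = (\<Sum>x\<in>{x\<in>\<Xi>. V (F x s) = w}. card ((#) x ` noise_words ws V (F x s)))"
    by (rule card_UN_disjoint) (auto simp: fin_\<Xi> finite_noise_words)
  also have "\<dots> = (\<Sum>x\<in>{x\<in>\<Xi>. V (F x s) = w}. card (noise_words ws V (F x s)))"
    by (intro sum.cong refl card_image) auto
  also have "\<dots> = (\<Sum>x\<in>\<Xi>. if V (F x s) = w then card (noise_words ws V (F x s)) else 0)"
    by (rule sum.inter_filter[OF fin_\<Xi>])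
  finally show ?thesis .
qed

lemma F_in_S: "x \<in> \<Xi> \<Longrightarrow> s \<in> S \<Longrightarrow> F x s \<in> S"
  using bij_F bij_betwE by blast

definition sample :: "('s \<times> (int \<Rightarrow> 'x)) measure" where
  "sample = uniform_count_measure S \<Otimes>\<^sub>M PiM UNIV (\<lambda>_. uniform_count_measure \<Xi>)"

primrec forward :: "nat \<Rightarrow> 's \<times> (int \<Rightarrow> 'x) \<Rightarrow> 's" where
  "forward 0 \<omega> = fst \<omega>"
| "forward (Suc m) \<omega> = F (snd \<omega> (int m)) (forward m \<omega>)"

primrec backward :: "nat \<Rightarrow> 's \<times> (int \<Rightarrow> 'x) \<Rightarrow> 's" where
  "backward 0 \<omega> = fst \<omega>"
| "backward (Suc m) \<omega> = inv_into S (F (snd \<omega> (- int m - 1))) (backward m \<omega>)"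

definition state :: "int \<Rightarrow> 's \<times> (int \<Rightarrow> 'x) \<Rightarrow> 's" where
  "state t = (if t \<ge> 0 then forward (nat t) else backward (nat (- t)))"

lemma prob_space_noise: "prob_space (uniform_count_measure \<Xi>)"
  using fin_\<Xi> \<Xi>_ne by (rule prob_space_uniform_count_measure)

sublocale noise: product_prob_space "\<lambda>_. uniform_count_measure \<Xi>" "UNIV :: int set"
proof -
  interpret prob_space "uniform_count_measure \<Xi>" by (rule prob_space_noise)
  show "product_prob_space (\<lambda>_. uniform_count_measure \<Xi>)" by unfold_locales
qed

sublocale sample: prob_space sample
proof -
  interpret A: prob_space "uniform_count_measure S"
    using fin_S S_ne by (rule prob_space_uniform_count_measure)
  interpret pair_prob_space "uniform_count_measure S" "PiM (UNIV :: int set) (\<lambda>_. uniform_count_measure \<Xi>)"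
    by unfold_locales
  show "prob_space sample" unfolding sample_def by unfold_locales
qed

lemma space_sample: "space sample = S \<times> (UNIV \<rightarrow>\<^sub>E \<Xi>)"
  by (simp add: sample_def space_pair_measure space_PiM space_uniform_count_measure)

lemma bij_forward:
  assumes "\<xi> \<in> UNIV \<rightarrow>\<^sub>E \<Xi>" shows "bij_betw (\<lambda>s. forward m (s, \<xi>)) S S"
proof (induction m)
  case (Suc m)
  have "bij_betw (F (\<xi> (int m)) \<circ> (\<lambda>s. forward m (s, \<xi>))) S S"
    using Suc assms by (intro bij_betw_trans[OF Suc] bij_F) auto
  then show ?case by (simp add: comp_def)
qed (simp add: bij_betw_def)

lemma bij_backward:
  assumes "\<xi> \<in> UNIV \<rightarrow>\<^sub>E \<Xi>" shows "bij_betw (\<lambda>s. backward m (s, \<xi>)) S S"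
proof (induction m)
  case (Suc m)
  have "bij_betw (inv_into S (F (\<xi> (- int m - 1))) \<circ> (\<lambda>s. backward m (s, \<xi>))) S S"
    using Suc assms by (intro bij_betw_trans[OF Suc] bij_betw_inv_into bij_F) auto
  then show ?case by (simp add: comp_def)
qed (simp add: bij_betw_def)

text \<open>This is where bijectivity enters: for fixed noise the state at time \<open>t\<close> is a bijective
  function of the state at time 0, also for negative \<open>t\<close>, so it inherits the uniform law.\<close>

lemma bij_state:
  assumes "\<xi> \<in> UNIV \<rightarrow>\<^sub>E \<Xi>" shows "bij_betw (\<lambda>s. state t (s, \<xi>)) S S"
  using bij_forward[OF assms] bij_backward[OF assms] by (simp add: state_def)

lemma state_in_S: "\<omega> \<in> space sample \<Longrightarrow> state t \<omega> \<in> S"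
  using bij_betwE[OF bij_state, of "snd \<omega>" t] by (cases \<omega>) (auto simp: space_sample)

lemma state_step:
  assumes "\<omega> \<in> space sample" shows "state (t + 1) \<omega> = F (snd \<omega> t) (state t \<omega>)"
proof (cases "t \<ge> 0")
  case True
  then have "nat (t + 1) = Suc (nat t)" by simp
  with True show ?thesis by (simp add: state_def)
next
  case False
  define m where "m = nat (- t - 1)"
  have t: "t = - int m - 1" and m: "nat (- t) = Suc m" using False by (auto simp: m_def)
  have "state (- int m) \<omega> = backward m \<omega>"
    by (cases m) (simp_all add: state_def del: of_nat_Suc)
  then have "state (t + 1) \<omega> = backward m \<omega>"
    by (simp add: t)
  moreover have "state t \<omega> = inv_into S (F (snd \<omega> t)) (backward m \<omega>)"
    using False m by (simp add: state_def t)
  moreover have "backward m \<omega> \<in> F (snd \<omega> t) ` S"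
  proof -
    have "backward m \<omega> \<in> S"
      using bij_betwE[OF bij_backward, of "snd \<omega>" m] assms by (cases \<omega>) (auto simp: space_sample)
    moreover have "snd \<omega> t \<in> \<Xi>" using assms by (auto simp: space_sample)
    ultimately show ?thesis using bij_F bij_betw_imp_surj_on by blast
  qed
  ultimately show ?thesis by (simp add: f_inv_into_f)
qed

lemma measurable_noise: "(\<lambda>\<omega>. snd \<omega> t) \<in> measurable sample (count_space \<Xi>)"
proof -
  have "(\<lambda>\<omega>. snd \<omega> t) \<in> measurable sample (uniform_count_measure \<Xi>)"
    unfolding sample_def by measurable
  then show ?thesis
    by (subst measurable_cong_sets[OF refl sets_uniform_count_measure_count_space[symmetric]])
qed

lemma measurable_apply_noise:
  assumes "f \<in> measurable sample (count_space S)" "\<And>x. x \<in> \<Xi> \<Longrightarrow> G x \<in> S \<rightarrow> S"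
  shows "(\<lambda>\<omega>. G (snd \<omega> t) (f \<omega>)) \<in> measurable sample (count_space S)"
proof (rule measurable_compose_countable'[OF _ measurable_noise])
  show "(\<lambda>\<omega>. G x (f \<omega>)) \<in> measurable sample (count_space S)" if "x \<in> \<Xi>" for x
    using measurable_compose[OF assms(1), of "G x"] assms(2)[OF that] by simp
qed (use fin_\<Xi> countable_finite in auto)

lemma measurable_state: "state t \<in> measurable sample (count_space S)"
proof -
  have "fst \<in> measurable sample (uniform_count_measure S)"
    unfolding sample_def by measurable
  then have 0: "fst \<in> measurable sample (count_space S)"
    by (subst measurable_cong_sets[OF refl sets_uniform_count_measure_count_space[symmetric]])
  have "forward m \<in> measurable sample (count_space S)" for m
  proof (induction m)
    case (Suc m)
    show ?case unfolding forward.simps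
      by (rule measurable_apply_noise[OF Suc]) (use F_in_S in blast)
  qed (use 0 in simp)
  moreover have "backward m \<in> measurable sample (count_space S)" for m
  proof (induction m)
    case (Suc m)
    show ?case unfolding backward.simps
      by (rule measurable_apply_noise[OF Suc, of "\<lambda>x. inv_into S (F x)"])
         (use bij_betwE[OF bij_betw_inv_into[OF bij_F]] in blast)
  qed (use 0 in simp)
  ultimately show ?thesis by (simp add: state_def)
qed

text \<open>The state at time \<open>a\<close> is uniform and independent of the noise from time \<open>a\<close> on. For
  \<open>a \<noteq> 0\<close> that state is itself a function of the noise, and for \<open>a < 0\<close> even of the noise in the
  window considered; integrating over the initial state first removes this dependence.\<close>

lemma prob_atom:
  fixes a :: int
  assumes s: "s \<in> S" and xs: "set xs \<subseteq> \<Xi>"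
  defines "A \<equiv> {\<omega>\<in>space sample. state a \<omega> = s \<and> (\<forall>k<length xs. snd \<omega> (a + int k) = xs ! k)}"
  shows "A \<in> sets sample"
    and "measure sample A = 1 / (real (card S) * real (card \<Xi>) ^ length xs)"
proof -
  let ?P = "PiM (UNIV :: int set) (\<lambda>_. uniform_count_measure \<Xi>)"
  define B where "B = {\<xi>\<in>space ?P. \<forall>k<length xs. \<xi> (a + int k) = xs ! k}"
  have xs_in: "xs ! k \<in> \<Xi>" if "k < length xs" for k using xs that by auto
  have "{\<omega>\<in>space sample. state a \<omega> = s} \<in> sets sample"
    using measurable_sets[OF measurable_state, of "{s}" a] s
    by (simp add: vimage_def Int_def conj_commute)
  moreover have "{\<omega>\<in>space sample. snd \<omega> (a + int k) = xs ! k} \<in> sets sample" if "k < length xs" for k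
    using measurable_sets[OF measurable_noise, of "{xs ! k}" "a + int k"] xs_in[OF that]
    by (simp add: vimage_def Int_def conj_commute)
  ultimately show A: "A \<in> sets sample"
    unfolding A_def by (intro sets.sets_Collect_conj sets.sets_Collect_finite_All') auto
  \<comment> \<open>For each fixed noise exactly one starting state leads to \<open>s\<close> at time \<open>a\<close>.\<close>
  have union: "(\<Union>s0\<in>S. Pair s0 -` A) = B"
  proof (intro equalityI subsetI)
    fix \<xi> assume \<xi>: "\<xi> \<in> B"
    then have "\<xi> \<in> UNIV \<rightarrow>\<^sub>E \<Xi>" by (auto simp: B_def space_PiM space_uniform_count_measure)
    moreover from bij_betw_imp_surj_on[OF bij_state[OF this], of a] s
    obtain s0 where "s0 \<in> S" "state a (s0, \<xi>) = s" by (auto elim!: equalityE)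
    ultimately show "\<xi> \<in> (\<Union>s0\<in>S. Pair s0 -` A)"
      using \<xi> by (auto simp: A_def B_def space_sample)
  qed (auto simp: A_def B_def space_sample space_PiM space_uniform_count_measure)
  have disj: "disjoint_family_on (\<lambda>s0. Pair s0 -` A) S"
  unfolding disjoint_family_on_def
  proof (intro ballI impI)
    fix s0 s1 assume "s0 \<in> S" "s1 \<in> S" "s0 \<noteq> s1"
    then have "state a (s0, \<xi>) \<noteq> state a (s1, \<xi>)" if "\<xi> \<in> UNIV \<rightarrow>\<^sub>E \<Xi>" for \<xi>
      using bij_betw_imp_inj_on[OF bij_state[OF that]] by (auto dest: inj_onD)
    then show "Pair s0 -` A \<inter> Pair s1 -` A = {}"
      by (auto simp: A_def space_sample) metis
  qed
  have "emeasure sample A = (\<integral>\<^sup>+s0. emeasure ?P (Pair s0 -` A) \<partial>uniform_count_measure S)"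
    using A unfolding sample_def by (rule noise.P.emeasure_pair_measure_alt)
  also have "\<dots> = (\<Sum>s0\<in>S. ennreal (1 / card S) * emeasure ?P (Pair s0 -` A))"
    unfolding uniform_count_measure_def by (rule nn_integral_point_measure_finite[OF fin_S])
  also have "\<dots> = ennreal (1 / card S) * (\<Sum>s0\<in>S. emeasure ?P (Pair s0 -` A))"
    by (simp add: sum_distrib_left)
  also have "(\<Sum>s0\<in>S. emeasure ?P (Pair s0 -` A)) = emeasure ?P B"
    unfolding union[symmetric] using A disj fin_S
    by (intro sum_emeasure) (auto simp: sample_def intro!: sets_Pair1)
  also have "emeasure ?P B = ennreal ((1 / card \<Xi>) ^ length xs)"
  proof -
    let ?J = "(\<lambda>k. a + int k) ` {..<length xs}"
    have "B = {\<xi>\<in>space ?P. \<forall>i\<in>?J. \<xi> i \<in> {xs ! nat (i - a)}}" by (auto simp: B_def)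
    also have "emeasure ?P \<dots> = (\<Prod>i\<in>?J. emeasure (uniform_count_measure \<Xi>) {xs ! nat (i - a)})"
      by (intro noise.emeasure_PiM_Collect) (auto simp: sets_uniform_count_measure xs_in)
    also have "\<dots> = (\<Prod>k<length xs. emeasure (uniform_count_measure \<Xi>) {xs ! k})"
      by (subst prod.reindex) (auto simp: inj_on_def)
    also have "\<dots> = (\<Prod>k<length xs. ennreal (1 / card \<Xi>))"
      by (intro prod.cong refl) (auto simp: emeasure_uniform_count_measure fin_\<Xi> xs_in)
    finally show ?thesis by (simp add: ennreal_power)
  qed
  finally have "emeasure sample A = ennreal (1 / card S * (1 / card \<Xi>) ^ length xs)"
    by (subst ennreal_mult) auto
  then show "measure sample A = 1 / (real (card S) * real (card \<Xi>) ^ length xs)"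
    by (simp add: measure_def power_divide)
qed

lemma readout_state:
  assumes "\<omega> \<in> space sample"
  shows "readout F V (state a \<omega>) (map (\<lambda>k. snd \<omega> (a + int k)) [0..<l])
    = map (\<lambda>k. V (state (a + 1 + int k) \<omega>)) [0..<l]"
proof (induction l arbitrary: a)
  case (Suc l)
  have "map (\<lambda>k. snd \<omega> (a + int k)) [0..<Suc l]
      = snd \<omega> a # map (\<lambda>k. snd \<omega> (a + 1 + int k)) [0..<l]"
    by (simp add: map_upt_Suc algebra_simps del: upt_Suc)
  moreover have "map (\<lambda>k. V (state (a + 1 + int k) \<omega>)) [0..<Suc l]
      = V (state (a + 1) \<omega>) # map (\<lambda>k. V (state (a + 1 + 1 + int k) \<omega>)) [0..<l]"
    by (simp add: map_upt_Suc algebra_simps del: upt_Suc)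
  ultimately show ?case
    using Suc[of "a + 1"] by (simp only: readout.simps state_step[OF assms, symmetric])
qed simp

text \<open>Consequently the law of an observable in a time window is obtained by counting pairs of
  an initial state and a noise word, and it does not depend on the position of the window.\<close>

lemma prob_path:
  fixes V :: "'s \<Rightarrow> 'v"
  shows "measure sample {\<omega>\<in>space sample. map (\<lambda>k. V (state (a + int k) \<omega>)) [0..<Suc (length ws)] = w0 # ws}
    = real (\<Sum>s | s \<in> S \<and> V s = w0. card (noise_words ws V s)) / (real (card S) * real (card \<Xi>) ^ length ws)"
proof -
  define Q where "Q = (SIGMA s:{s\<in>S. V s = w0}. noise_words ws V s)"
  define A where "A = (\<lambda>(s, xs). {\<omega>\<in>space sample. state a \<omega> = s
    \<and> (\<forall>k<length xs. snd \<omega> (a + int k) = xs ! k)})"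
  have Q: "finite Q" unfolding Q_def by (intro finite_SigmaI) (use fin_S finite_noise_words in auto)
  have len: "length xs = length ws" "set xs \<subseteq> \<Xi>" if "xs \<in> noise_words ws V s" for xs s
    using that by (auto simp: noise_words_def)
  have "{\<omega>\<in>space sample. map (\<lambda>k. V (state (a + int k) \<omega>)) [0..<Suc (length ws)] = w0 # ws}
      = (\<Union>q\<in>Q. A q)"
  proof (intro equalityI subsetI)
    fix \<omega> assume *: "\<omega> \<in> {\<omega>\<in>space sample. map (\<lambda>k. V (state (a + int k) \<omega>)) [0..<Suc (length ws)] = w0 # ws}"
    let ?xs = "map (\<lambda>k. snd \<omega> (a + int k)) [0..<length ws]"
    have "readout F V (state a \<omega>) ?xs = ws"
      using * by (simp add: readout_state map_upt_Suc add.assoc del: upt_Suc)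
    then have "(state a \<omega>, ?xs) \<in> Q"
      using * by (auto simp: Q_def noise_words_def state_in_S space_sample map_upt_Suc simp del: upt_Suc)
    then show "\<omega> \<in> (\<Union>q\<in>Q. A q)" using * by (intro UN_I) (auto simp: A_def)
  next
    fix \<omega> assume "\<omega> \<in> (\<Union>q\<in>Q. A q)"
    then obtain s xs where q: "s \<in> S" "V s = w0" "xs \<in> noise_words ws V s" and \<omega>: "\<omega> \<in> space sample"
      and st: "state a \<omega> = s" and noi: "\<forall>k<length xs. snd \<omega> (a + int k) = xs ! k"
      by (auto simp: Q_def A_def)
    have "xs = map (\<lambda>k. snd \<omega> (a + int k)) [0..<length ws]"
      using noi len[OF q(3)] by (intro nth_equalityI) auto
    then have "map (\<lambda>k. V (state (a + 1 + int k) \<omega>)) [0..<length ws] = ws"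
      using q(3) st by (simp add: noise_words_def readout_state[OF \<omega>, symmetric])
    then show "\<omega> \<in> {\<omega>\<in>space sample. map (\<lambda>k. V (state (a + int k) \<omega>)) [0..<Suc (length ws)] = w0 # ws}"
      using \<omega> st q by (simp add: map_upt_Suc add.assoc del: upt_Suc)
  qed
  also have "measure sample (\<Union>q\<in>Q. A q) = (\<Sum>q\<in>Q. measure sample (A q))"
  proof (rule sample.finite_measure_finite_Union[OF Q])
    show "A ` Q \<subseteq> sets sample"
    proof
      fix B assume "B \<in> A ` Q"
      then obtain s xs where "s \<in> S" "xs \<in> noise_words ws V s" "B = A (s, xs)"
        by (auto simp: Q_def)
      then show "B \<in> sets sample" using prob_atom(1)[of s xs a] len by (simp add: A_def)
    qed
    show "disjoint_family_on A Q"
      unfolding disjoint_family_on_def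
    proof (intro ballI impI)
      fix p q assume pq: "p \<in> Q" "q \<in> Q" "p \<noteq> q"
      obtain s xs t ys where [simp]: "p = (s, xs)" "q = (t, ys)" by (cases p, cases q) auto
      have "length xs = length ys" using pq len by (auto simp: Q_def)
      then have "s = t \<Longrightarrow> \<exists>k<length xs. xs ! k \<noteq> ys ! k"
        using pq(3) by (auto simp: list_eq_iff_nth_eq)
      then show "A p \<inter> A q = {}"
        using \<open>length xs = length ys\<close> by (fastforce simp: A_def)
    qed
  qed
  also have "\<dots> = (\<Sum>q\<in>Q. 1 / (real (card S) * real (card \<Xi>) ^ length ws))"
  proof (rule sum.cong[OF refl])
    fix q assume "q \<in> Q"
    then obtain s xs where "s \<in> S" "xs \<in> noise_words ws V s" "q = (s, xs)"
      by (auto simp: Q_def)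
    then show "measure sample (A q) = 1 / (real (card S) * real (card \<Xi>) ^ length ws)"
      using prob_atom(2)[of s xs a] len[of xs s] by (simp add: A_def)
  qed
  also have "\<dots> = real (card Q) / (real (card S) * real (card \<Xi>) ^ length ws)" by simp
  also have "card Q = (\<Sum>s | s \<in> S \<and> V s = w0. card (noise_words ws V s))"
    unfolding Q_def by (rule card_SigmaI) (use fin_S finite_noise_words in auto)
  finally show ?thesis .
qed

end

section \<open>Random walks by counting paths\<close>

lemma window_eq_iff_map_eq:
  fixes a :: int
  shows "(\<forall>s\<in>{a..a + int m}. X s = w s)
    \<longleftrightarrow> map (\<lambda>k. X (a + int k)) [0..<Suc m] = map (\<lambda>k. w (a + int k)) [0..<Suc m]"
proof -
  have "{a..a + int m} = (\<lambda>k. a + int k) ` {..m}"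
  proof (intro equalityI subsetI)
    fix s assume "s \<in> {a..a + int m}"
    then show "s \<in> (\<lambda>k. a + int k) ` {..m}" by (intro image_eqI[of _ _ "nat (s - a)"]) auto
  qed auto
  moreover have "set [0..<Suc m] = {..m}" by auto
  ultimately show ?thesis by (simp add: map_eq_conv del: upt_Suc set_upt)
qed

lemma neighbors_complete_graph:
  "u \<in> {1..N} \<Longrightarrow> neighbors (complete_graph N) u = {1..N} - {u}"
  unfolding neighbors_def complete_graph_def by (auto simp: doubleton_eq_iff) blast

context noise_driven
begin

text \<open>If each further step multiplies the number of noise words producing a path by the same
  factor \<open>q\<close>, then by \<open>prob_path\<close> the probability of the next vertex given the history is the
  ratio \<open>q / card \<Xi>\<close>. The factor \<open>K w\<close> that belongs to the first vertex cancels in it.\<close>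

lemma walk_if_path_counts_geometric:
  fixes V :: "'s \<Rightarrow> nat"
  assumes V: "\<And>s. s \<in> S \<Longrightarrow> V s \<in> {1..N}"
    and moves: "\<And>x s. x \<in> \<Xi> \<Longrightarrow> s \<in> S \<Longrightarrow> V (F x s) \<noteq> V s"
    and count: "\<And>w ws. w \<in> {1..N} \<Longrightarrow> set ws \<subseteq> {1..N} \<Longrightarrow> distinct_adj (w # ws) \<Longrightarrow>
      (\<Sum>s | s \<in> S \<and> V s = w. card (noise_words ws V s)) = K w * q ^ length ws"
    and q: "card \<Xi> = q * (N - 1)"
  shows "simple_random_walk sample N (complete_graph N) (\<lambda>t \<omega>. V (state t \<omega>))"
  unfolding simple_random_walk_def
proof (intro conjI allI impI)
  show "prob_space sample" by unfold_locales
  show "simple_graph N (complete_graph N)" by (simp add: simple_graph_def)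
  show "(\<lambda>\<omega>. V (state t \<omega>)) \<in> measurable sample (count_space {1..N})" for t
    using measurable_compose[OF measurable_state, of V] V by auto
next
  fix t :: int and l :: nat and w :: "int \<Rightarrow> nat" and v :: nat
  assume l: "1 \<le> l" and w: "\<forall>s\<in>{t - int l..t - 1}. w s \<in> {1..N}"
    and pos: "\<P>(\<omega> in sample. \<forall>s\<in>{t - int l..t - 1}. V (state s \<omega>) = w s) > 0"
    and v: "v \<in> neighbors (complete_graph N) (w (t - 1))"
  obtain m where m: "l = Suc m" using l by (cases l) auto
  define a where "a = t - int l"
  define ws where "ws = map (\<lambda>k. w (a + 1 + int k)) [0..<m]"
  have win: "{t - int l..t - 1} = {a..a + int m}" by (simp add: a_def m)
  have t: "t = a + int (Suc m)" by (simp add: a_def m)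
  have len: "length ws = m" by (simp add: ws_def)
  have nodes: "w (a + int k) \<in> {1..N}" if "k \<le> m" for k using w that unfolding win by auto
  have hist: "map (\<lambda>k. w (a + int k)) [0..<Suc m] = w a # ws"
    by (simp add: ws_def map_upt_Suc algebra_simps del: upt_Suc)
  have past: "(\<forall>s\<in>{t - int l..t - 1}. V (state s \<omega>) = w s)
      \<longleftrightarrow> map (\<lambda>k. V (state (a + int k) \<omega>)) [0..<Suc (length ws)] = w a # ws" for \<omega>
    unfolding win window_eq_iff_map_eq hist len ..
  have now: "V (state t \<omega>) = v \<and> (\<forall>s\<in>{t - int l..t - 1}. V (state s \<omega>) = w s)
      \<longleftrightarrow> map (\<lambda>k. V (state (a + int k) \<omega>)) [0..<Suc (length (ws @ [v]))] = w a # (ws @ [v])" for \<omega>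
    unfolding past using t by (simp add: len) auto
  have v': "v \<in> {1..N}" "v \<noteq> w (a + int m)"
    using v neighbors_complete_graph[OF nodes[of m]] t by auto
  have sets: "w a \<in> {1..N}" "set ws \<subseteq> {1..N}" "set (ws @ [v]) \<subseteq> {1..N}"
    using nodes[of 0] nodes[of "Suc _"] v' by (auto simp: ws_def algebra_simps)
  obtain \<omega> where \<omega>: "\<omega> \<in> space sample"
    and at: "map (\<lambda>k. V (state (a + int k) \<omega>)) [0..<Suc m] = w a # ws"
  proof -
    define Q where "Q \<omega> \<longleftrightarrow> (\<forall>s\<in>{t - int l..t - 1}. V (state s \<omega>) = w s)" for \<omega>
    have "{\<omega>\<in>space sample. Q \<omega>} \<noteq> {}" using pos unfolding Q_def by force
    then obtain \<omega> where "\<omega> \<in> space sample" "Q \<omega>" by blast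
    then show ?thesis using that past len unfolding Q_def by simp
  qed
  \<comment> \<open>A history of positive probability occurs at some sample point, so it never stands still,
    as \<open>count\<close> requires.\<close>
  have "V (state (a + int (Suc i)) \<omega>) \<noteq> V (state (a + int i) \<omega>)" for i
  proof -
    have "snd \<omega> (a + int i) \<in> \<Xi>" using \<omega> by (auto simp: space_sample)
    then show ?thesis
      using moves[OF _ state_in_S[OF \<omega>]] state_step[OF \<omega>, of "a + int i"] by (simp add: algebra_simps)
  qed
  then have adj: "distinct_adj (w a # ws)"
    unfolding at[symmetric] distinct_adj_conv_nth
    by (intro allI impI) (simp add: eq_commute del: upt_Suc of_nat_Suc)
  have adj': "distinct_adj (w a # ws @ [v])"
  proof -
    have "last (w a # ws) = w (a + int m)"
      unfolding hist[symmetric] by simp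
    then show ?thesis
      using adj v'(2) distinct_adj_append_iff[of "w a # ws" "[v]"] by (simp del: distinct_adj_Cons_Cons)
  qed
  have P: "\<P>(\<omega> in sample. \<forall>s\<in>{t - int l..t - 1}. V (state s \<omega>) = w s)
      = real (K (w a) * q ^ m) / (real (card S) * real (card \<Xi>) ^ m)"
    using prob_path[of V a ws "w a"] unfolding past count[OF sets(1,2) adj] len .
  have P': "\<P>(\<omega> in sample. V (state t \<omega>) = v \<and> (\<forall>s\<in>{t - int l..t - 1}. V (state s \<omega>) = w s))
      = real (K (w a) * q ^ Suc m) / (real (card S) * real (card \<Xi>) ^ Suc m)"
    using prob_path[of V a "ws @ [v]" "w a"] unfolding now count[OF sets(1,3) adj']
    by (simp add: len del: upt_Suc)
  have \<Xi>: "card \<Xi> \<noteq> 0" using fin_\<Xi> \<Xi>_ne by simp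
  then have "q \<noteq> 0" using q by auto
  moreover have "K (w a) \<noteq> 0" using pos unfolding P by (cases "K (w a) = 0") simp_all
  moreover have "card S \<noteq> 0" using fin_S S_ne by simp
  ultimately have "\<P>(\<omega> in sample. V (state t \<omega>) = v \<bar> \<forall>s\<in>{t - int l..t - 1}. V (state s \<omega>) = w s)
      = real q / real (card \<Xi>)"
    unfolding cond_prob_def P P' using \<Xi> by simp
  also have "\<dots> = 1 / real (N - 1)" unfolding q using \<open>q \<noteq> 0\<close> by simp
  also have "N - 1 = vertex_degree (complete_graph N) (w (t - 1))"
    using neighbors_complete_graph[OF nodes[of m]] nodes[of m] t by (simp add: vertex_degree_def)
  finally show "\<P>(\<omega> in sample. V (state t \<omega>) = v \<bar> \<forall>s\<in>{t - int l..t - 1}. V (state s \<omega>) = w s)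
      = 1 / real (vertex_degree (complete_graph N) (w (t - 1)))" .
qed

end

section \<open>Numbers under XOR and their leading bits\<close>

unbundle bit_operations_syntax

lemma less_two_power_iff_no_high_bit:
  fixes x :: nat
  shows "x < 2 ^ m \<longleftrightarrow> (\<forall>j\<ge>m. \<not> bit x j)"
proof -
  have "x < 2 ^ m \<longleftrightarrow> take_bit m x = x" by (simp add: take_bit_nat_eq_self_iff)
  also have "\<dots> \<longleftrightarrow> (\<forall>j. (j < m \<and> bit x j) = bit x j)"
    by (simp add: bit_eq_iff bit_take_bit_iff)
  also have "\<dots> \<longleftrightarrow> (\<forall>j\<ge>m. \<not> bit x j)" by (meson not_less)
  finally show ?thesis .
qed

lemma xor_less_two_power:
  fixes x y :: nat
  shows "x < 2 ^ m \<Longrightarrow> y < 2 ^ m \<Longrightarrow> x XOR y < 2 ^ m"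
  by (auto simp: less_two_power_iff_no_high_bit bit_xor_iff)

lemma xor_left_self [simp]: "x XOR (x XOR y) = (y :: nat)"
  by (simp flip: xor.assoc)

lemma xor_eq_0_iff: "x XOR y = 0 \<longleftrightarrow> x = (y :: nat)"
  by (metis xor_left_self xor.right_neutral xor_self_eq)

lemma xor_cancel: "x XOR y = x XOR z \<longleftrightarrow> y = (z :: nat)"
  by (metis xor_left_self)

lemma bit_two_power_xor:
  fixes e :: nat
  assumes "e < 2 ^ J" shows "bit (2 ^ J XOR e) J" "2 ^ J XOR e < 2 ^ Suc J"
  using assms unfolding less_two_power_iff_no_high_bit
  by (auto simp: bit_xor_iff bit_exp_iff)

lemma two_power_xor_eq_add:
  fixes e :: nat
  assumes "e < 2 ^ J" shows "2 ^ J XOR e = 2 ^ J + e"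
proof (rule disjunctive_add_eq_xor[symmetric], rule bit_eqI)
  fix j
  have "\<not> bit e J" using assms by (auto simp: less_two_power_iff_no_high_bit)
  then show "bit (2 ^ J AND e) j \<longleftrightarrow> bit 0 j" by (auto simp: bit_and_iff bit_exp_iff)
qed

lemma level_unique:
  fixes x :: nat
  assumes "bit x i" "x < 2 ^ Suc i" "bit x j" "x < 2 ^ Suc j" shows "i = j"
  using assms by (metis less_two_power_iff_no_high_bit not_less_eq_eq nle_le)

lemma leading_difference_bit:
  fixes a b :: nat
  assumes "a < b" shows "\<exists>m. \<not> bit a m \<and> bit b m \<and> (\<forall>j>m. bit a j = bit b j)"
  using assms
proof (induction b arbitrary: a rule: less_induct)
  case (less b)
  show ?case
  proof (cases "a div 2 = b div 2")
    case True
    then have "\<not> bit a 0 \<and> bit b 0" using less.prems by (simp add: bit_0) presburger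
    moreover have "bit a j = bit b j" if "j > 0" for j
      using that True by (cases j) (simp_all add: bit_Suc)
    ultimately show ?thesis by blast
  next
    case False
    then have "a div 2 < b div 2" "b div 2 < b" using less.prems by auto
    from less.IH[OF this(2,1)] obtain m where
      "\<not> bit (a div 2) m" "bit (b div 2) m" "\<forall>j>m. bit (a div 2) j = bit (b div 2) j" by blast
    moreover have "bit a j = bit b j" if "j > Suc m" for j
      using that calculation(3) by (cases j) (simp_all add: bit_Suc)
    ultimately show ?thesis by (intro exI[of _ "Suc m"]) (auto simp: bit_Suc)
  qed
qed

section \<open>Offsets of the walkers and avoidance\<close>

text \<open>A pending jump of level \<open>J\<close> is stored as \<open>E J < 2 ^ J\<close>, standing for the number
  \<open>2 ^ J XOR E J\<close>. The offset is the position of the walker labelled \<open>a\<close> relative to the walker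
  labelled 0, as far as it comes from the levels up to the last argument. Labels are even,
  so level 0 does not occur: in a round of level 0 all walkers jump by 1.\<close>

primrec offset :: "(nat \<Rightarrow> nat) \<Rightarrow> nat \<Rightarrow> nat \<Rightarrow> nat" where
  "offset E a 0 = 0"
| "offset E a (Suc J) = (if bit a (Suc J) then 2 ^ Suc J XOR E (Suc J) XOR 1 else 0) XOR offset E a J"

text \<open>When a level-\<open>J\<close> round replaces \<open>E J\<close> by \<open>E J XOR r\<close>, walkers with bit \<open>J\<close> unset
  use the old pending jump, and those with bit \<open>J\<close> set already use the new one.\<close>

definition jump :: "(nat \<Rightarrow> nat) \<Rightarrow> nat \<Rightarrow> nat \<Rightarrow> nat \<Rightarrow> nat" where
  "jump E r a J = 2 ^ J XOR (if bit a J then E J XOR r else E J)"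

lemma offset_update:
  assumes "even a"
  shows "offset (E(J := x)) a K = offset E a K XOR (if J \<le> K \<and> bit a J then E J XOR x else 0)"
proof (induction K)
  case 0
  then show ?case using assms by (auto simp: bit_0)
next
  case (Suc K)
  show ?case
  proof (cases "J = Suc K")
    case True
    then have "offset (E(J := x)) a K = offset E a K" using Suc by (simp del: fun_upd_apply)
    moreover have "(E(J := x)) (Suc K) = x" using True by simp
    ultimately have "offset (E(J := x)) a (Suc K)
        = (if bit a (Suc K) then 2 ^ Suc K XOR x XOR 1 else 0) XOR offset E a K"
      by (simp only: offset.simps)
    also have "\<dots> = offset E a (Suc K) XOR (if J \<le> Suc K \<and> bit a J then E J XOR x else 0)"
      using True by (simp add: ac_simps)
    finally show ?thesis .
  next
    case False
    then have "J \<le> Suc K \<longleftrightarrow> J \<le> K" by auto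
    then show ?thesis using False Suc by (simp add: ac_simps)
  qed
qed

lemma offset_less:
  assumes "\<And>J. J \<le> K \<Longrightarrow> E J < 2 ^ J" shows "offset E a K < 2 ^ Suc K"
  using assms
proof (induction K)
  case (Suc K)
  have "2 ^ Suc K XOR E (Suc K) < 2 ^ Suc (Suc K)"
    by (intro bit_two_power_xor Suc.prems) simp
  moreover have "(1 :: nat) < 2 ^ Suc (Suc K)"
    by (rule one_less_power) auto
  moreover have "offset E a K < 2 ^ Suc (Suc K)"
    using Suc.IH Suc.prems by (simp add: less_Suc_eq_le less_imp_le_nat trans_less_add1)
  ultimately show ?case
    unfolding offset.simps by (auto intro!: xor_less_two_power simp del: power_Suc simp flip: xor.assoc)
qed auto

text \<open>If \<open>a\<close> and \<open>b\<close> differ in a bit, then the contribution of that level has a higher leading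
  bit than all that comes from lower levels, so nothing can cancel it.\<close>

lemma leading_bit_offset_gap:
  assumes E: "\<And>J. J \<le> Suc K \<Longrightarrow> E J < 2 ^ J"
    and ab: "bit a (Suc K) \<noteq> bit b (Suc K)"
  defines "gap \<equiv> offset E a (Suc K) XOR offset E b (Suc K)"
  shows "gap = 2 ^ Suc K XOR E (Suc K) XOR 1 XOR (offset E a K XOR offset E b K)"
    and "bit gap (Suc K)" and "gap < 2 ^ Suc (Suc K)"
proof -
  show *: "gap = 2 ^ Suc K XOR E (Suc K) XOR 1 XOR (offset E a K XOR offset E b K)"
    using ab by (cases "bit a (Suc K)") (simp_all add: gap_def ac_simps)
  have "offset E a K < 2 ^ Suc K" "offset E b K < 2 ^ Suc K"
    using E by (intro offset_less; simp)+
  moreover have "(1 :: nat) < 2 ^ Suc K" by (rule one_less_power) auto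
  ultimately have "E (Suc K) XOR 1 XOR (offset E a K XOR offset E b K) < 2 ^ Suc K"
    using E[of "Suc K"] by (intro xor_less_two_power) simp_all
  from bit_two_power_xor[OF this] show "bit gap (Suc K)" "gap < 2 ^ Suc (Suc K)"
    unfolding * by (simp_all add: ac_simps)
qed

text \<open>Since offsets have no contribution from level 0, a nonzero separation has its leading bit at
  a level at least 1.\<close>

lemma offset_gap_neq_1:
  assumes "\<And>J. J \<le> K \<Longrightarrow> E J < 2 ^ J"
  shows "offset E a K XOR offset E b K \<noteq> 1"
  using assms
proof (induction K)
  case (Suc K)
  show ?case
  proof (cases "bit a (Suc K) = bit b (Suc K)")
    case True
    then have "offset E a (Suc K) XOR offset E b (Suc K) = offset E a K XOR offset E b K"
      by (simp add: ac_simps)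
    then show ?thesis using Suc by auto
  next
    case False
    have "bit (offset E a (Suc K) XOR offset E b (Suc K)) (Suc K)"
      using leading_bit_offset_gap(2) Suc.prems False by blast
    then show ?thesis by (metis bit_1_iff nat.simps(3))
  qed
qed simp

lemma offset_gap_agree:
  assumes "m \<le> K" "\<And>j. m < j \<Longrightarrow> bit a j = bit b j"
  shows "offset E a K XOR offset E b K = offset E a m XOR offset E b m"
  using assms
proof (induction K rule: dec_induct)
  case (step K)
  then have "bit a (Suc K) = bit b (Suc K)" by auto
  then have "offset E a (Suc K) XOR offset E b (Suc K) = offset E a K XOR offset E b K"
    by (simp add: ac_simps)
  then show ?case using step by simp
qed simp

text \<open>Let \<open>m\<close> be the highest bit in which \<open>a < b\<close> differ; it is unset in \<open>a\<close>. The separation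
  of the two positions has leading bit \<open>m\<close>, and a jump of level \<open>J\<close> has leading bit \<open>J\<close>, so
  they can agree only if \<open>J = m\<close>. In that case \<open>a\<close> uses the old pending jump, whereas the separation
  is this jump XOR 1 XOR the separation caused by lower levels, and the latter is not 1.\<close>

lemma offset_avoids:
  assumes E: "\<And>J. J \<le> d \<Longrightarrow> E J < 2 ^ J" and ab: "even a" "even b" "a < b" "b < 2 ^ Suc d"
  shows "offset E a d \<noteq> offset E b d"
    and "J \<le> d \<Longrightarrow> r < 2 ^ J \<Longrightarrow> offset E a d XOR jump E r a J \<noteq> offset E b d"
proof -
  obtain m where m: "\<not> bit a m" "bit b m" "\<forall>j>m. bit a j = bit b j"
    using leading_difference_bit[OF ab(3)] by blast
  have "m \<noteq> 0" using m(2) ab(2) by (metis bit_0)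
  then obtain K where K: "m = Suc K" by (cases m) auto
  have "m \<le> d" using m(2) ab(4) by (metis less_two_power_iff_no_high_bit not_less_eq_eq)
  define gap where "gap = offset E a m XOR offset E b m"
  have gap: "offset E a d XOR offset E b d = gap"
    unfolding gap_def using \<open>m \<le> d\<close> m(3) by (intro offset_gap_agree) auto
  have EK: "\<And>J. J \<le> Suc K \<Longrightarrow> E J < 2 ^ J" using E \<open>m \<le> d\<close> K by auto
  have lead: "gap = 2 ^ m XOR E m XOR 1 XOR (offset E a K XOR offset E b K)"
    "bit gap m" "gap < 2 ^ Suc m"
    using leading_bit_offset_gap[of K E a b, OF EK] m(1,2) unfolding gap_def K by auto
  show "offset E a d \<noteq> offset E b d"
    using lead(2) gap by auto
  assume J: "J \<le> d" "r < 2 ^ J"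
  show "offset E a d XOR jump E r a J \<noteq> offset E b d"
  proof
    assume "offset E a d XOR jump E r a J = offset E b d"
    then have eq: "gap = jump E r a J" unfolding gap[symmetric] by (metis xor_left_self)
    have "(if bit a J then E J XOR r else E J) < 2 ^ J"
      using E[OF J(1)] J(2) xor_less_two_power by auto
    from bit_two_power_xor[OF this] have "bit gap J" "gap < 2 ^ Suc J"
      unfolding eq jump_def by auto
    then have "J = m" using lead(2,3) level_unique by blast
    then have "jump E r a J = 2 ^ m XOR E m" using m(1) by (simp add: jump_def)
    with eq lead(1) have "(2 ^ m XOR E m) XOR (1 XOR (offset E a K XOR offset E b K))
        = (2 ^ m XOR E m) XOR 0"
      by (simp add: xor.assoc)
    then have "1 XOR (offset E a K XOR offset E b K) = 0" by (simp only: xor_cancel)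
    then have "offset E a K XOR offset E b K = 1" by (simp add: xor_eq_0_iff)
    then show False using offset_gap_neq_1[of K E a b] EK by simp
  qed
qed

section \<open>Relabelling the vertices\<close>

text \<open>For \<open>n\<close> a power of two and \<open>c < n\<close> this swaps \<open>y < n\<close> with \<open>n + (y XOR c)\<close> whenever the
  latter is below \<open>N\<close>; for \<open>c \<ge> n\<close> it is the identity. Thus each pair of a number below \<open>n\<close>
  and one from \<open>n\<close> to \<open>N - 1\<close> is swapped for exactly one \<open>c\<close>, and if \<open>c\<close> is uniform
  below \<open>N - 1\<close> it is swapped with probability \<open>1 / (N - 1)\<close>.\<close>

definition relabel :: "nat \<Rightarrow> nat \<Rightarrow> nat \<Rightarrow> nat \<Rightarrow> nat" where
  "relabel N n c y = (if c < n \<and> y < N \<and> y XOR (n XOR c) < N then y XOR (n XOR c) else y)"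

lemma relabel_involution: "relabel N n c (relabel N n c y) = y"
  by (auto simp: relabel_def xor.assoc)

lemma relabel_permutes: "relabel N n c permutes {..<N}"
proof (rule bij_imp_permutes)
  show "bij_betw (relabel N n c) {..<N} {..<N}"
    by (rule bij_betw_byWitness[where f' = "relabel N n c"])
       (auto simp: relabel_involution, auto simp: relabel_def)
qed (auto simp: relabel_def)

locale xor_coupling =
  fixes d n N :: nat
  assumes n: "n = 2 ^ Suc d" and nN: "n \<le> N" "N < 2 * n"
begin

lemma xor_less: "x < n \<Longrightarrow> y < n \<Longrightarrow> x XOR y < n"
  unfolding n by (rule xor_less_two_power)

lemma xor_across:
  assumes "y < n" "c < n" shows "y XOR (n XOR c) = n + (y XOR c)"
proof -
  have "y XOR c < n" using assms by (rule xor_less)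
  then have "n XOR (y XOR c) = n + (y XOR c)" unfolding n by (rule two_power_xor_eq_add)
  then show ?thesis by (simp add: ac_simps)
qed

lemma relabel_fixes_low: "y < n \<Longrightarrow> relabel N n c y < n \<Longrightarrow> relabel N n c y = y"
  by (auto simp: relabel_def xor_across split: if_splits)

text \<open>A walker at \<open>u\<close> that moves to a uniform other \<open>y < n\<close>, followed by a random relabelling,
  reaches every \<open>v \<noteq> u\<close> in equally many ways. For \<open>v < n\<close> it must move to \<open>v\<close>, and \<open>N - n\<close> of the
  \<open>N - 1\<close> relabellings move \<open>v\<close> away; for \<open>v \<ge> n\<close> every \<open>y \<noteq> u\<close> is swapped with \<open>v\<close> by exactly
  one relabelling.\<close>

lemma card_relabel_to:
  assumes u: "u < n" and v: "v < N" "v \<noteq> u"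
  shows "card {(y, c). y < n \<and> y \<noteq> u \<and> c < N - 1 \<and> relabel N n c y = v} = n - 1"
proof (cases "v < n")
  case True
  have "relabel N n c v = v \<longleftrightarrow> \<not> (c < n \<and> v XOR c \<in> {..<N - n})" for c
    using True by (auto simp: relabel_def xor_across)
  then have "{(y, c). y < n \<and> y \<noteq> u \<and> c < N - 1 \<and> relabel N n c y = v}
      = {v} \<times> ({..<N - 1} - (\<lambda>q. v XOR q) ` {..<N - n})"
    (is "?L = _ \<times> (_ - ?X)")
  proof -
    have X: "c \<in> ?X \<longleftrightarrow> c < n \<and> v XOR c \<in> {..<N - n}" for c
    proof
      assume "c \<in> ?X"
      then obtain q where "q < N - n" "c = v XOR q" by auto
      moreover have "q < n" using calculation nN by auto
      ultimately show "c < n \<and> v XOR c \<in> {..<N - n}"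
        using True xor_less by auto
    next
      assume "c < n \<and> v XOR c \<in> {..<N - n}"
      then show "c \<in> ?X" by (intro image_eqI[of _ _ "v XOR c"]) auto
    qed
    have "relabel N n c y = v \<and> y < n \<longleftrightarrow> y = v \<and> relabel N n c v = v" for y c
      using True relabel_fixes_low by metis
    then show ?thesis
      using True v(2) X \<open>\<And>c. relabel N n c v = v \<longleftrightarrow> _\<close> by auto
  qed
  moreover have "(\<lambda>q. v XOR q) ` {..<N - n} \<subseteq> {..<N - 1}"
  proof (cases "N = n")
    case False
    have "v XOR q < n" if "q < N - n" for q
      using that nN True by (intro xor_less) auto
    then show ?thesis using False nN by force
  qed auto
  moreover have "card ((\<lambda>q. v XOR q) ` {..<N - n}) = N - n"
    by (subst card_image) (auto simp: inj_on_def xor_cancel)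
  ultimately show ?thesis using nN by (simp add: card_Diff_subset)
next
  case False
  define c where "c y = y XOR (n XOR v)" for y
  have vn: "n XOR v = v - n" "v - n < n"
  proof -
    show "v - n < n" using v nN by auto
    then have "n XOR (v - n) = n + (v - n)" unfolding n by (rule two_power_xor_eq_add)
    then have "v = n XOR (v - n)" using False by auto
    then show "n XOR v = v - n" by (metis xor_left_self)
  qed
  have c_less: "c y < n" if "y < n" for y
    unfolding c_def vn using that vn(2) by (rule xor_less)
  have "relabel N n c' y = v \<longleftrightarrow> c' = c y" if "y < n" for y c'
  proof
    assume "relabel N n c' y = v"
    then have "y XOR (n XOR c') = v" using that False by (auto simp: relabel_def split: if_splits)
    then show "c' = c y" unfolding c_def by (metis xor_left_self xor.left_commute)
  next
    assume c': "c' = c y"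
    then have "y XOR (n XOR c') = v" unfolding c_def by (metis xor_left_self xor.left_commute)
    then show "relabel N n c' y = v"
      using that c_less[OF that] v nN unfolding relabel_def c' by auto
  qed
  then have "{(y, c). y < n \<and> y \<noteq> u \<and> c < N - 1 \<and> relabel N n c y = v}
      = (\<lambda>y. (y, c y)) ` ({..<n} - {u})"
    using c_less False v by fastforce
  also have "card \<dots> = card ({..<n} - {u})" by (rule card_image) (auto simp: inj_on_def)
  finally show ?thesis using u by simp
qed

text \<open>Drawing a level with weight \<open>2 ^ J\<close> and then a uniform jump of that level amounts to drawing a
  uniform nonzero jump.\<close>

lemma bij_jumps:
  assumes u: "u < n"
  shows "bij_betw (\<lambda>(J, e). u XOR (2 ^ J XOR e)) (SIGMA J:{..d}. {..<2 ^ J}) ({..<n} - {u})"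
proof -
  let ?f = "\<lambda>(J, e). u XOR (2 ^ J XOR e)" and ?A = "SIGMA J:{..d}. {..<(2 :: nat) ^ J}"
  have "card ?A = (\<Sum>J\<le>d. 2 ^ J)" by (subst card_SigmaI) auto
  also have "\<dots> = n - 1" using sum_power2[of "Suc d"] unfolding n by (simp add: lessThan_Suc_atMost atLeast0LessThan)
  finally have card: "card ?A = card ({..<n} - {u})" using u by simp
  have surj: "?f ` ?A = {..<n} - {u}"
  proof (intro equalityI subsetI)
    fix y assume "y \<in> ?f ` ?A"
    then obtain J e where Je: "J \<le> d" "e < 2 ^ J" "y = u XOR (2 ^ J XOR e)" by auto
    have "(2 :: nat) ^ Suc J \<le> 2 ^ Suc d" using Je(1) by (intro power_increasing) auto
    then have "2 ^ J XOR e < n" unfolding n using bit_two_power_xor(2)[OF Je(2)] by linarith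
    moreover have "2 ^ J XOR e \<noteq> 0" using bit_two_power_xor(1)[OF Je(2)] by (metis bit_0_eq bot_apply bot_bool_def)
    ultimately show "y \<in> {..<n} - {u}"
      using xor_less[OF u] xor_cancel[of u "2 ^ J XOR e" 0] Je(3) by simp
  next
    fix y assume y: "y \<in> {..<n} - {u}"
    define z where "z = u XOR y"
    have z: "z < n" "z \<noteq> 0" using y u xor_less by (auto simp: z_def xor_eq_0_iff)
    then obtain J where J: "2 ^ J \<le> z" "z < 2 ^ (J + 1)"
      using ex_power_ivl1[of 2 z] by auto
    have "J \<le> d"
    proof (rule ccontr)
      assume "\<not> J \<le> d"
      then have "(2 :: nat) ^ Suc d \<le> 2 ^ J" by (intro power_increasing) auto
      then show False using J z n by auto
    qed
    moreover have e: "z - 2 ^ J < 2 ^ J" using J by auto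
    moreover have "2 ^ J XOR (z - 2 ^ J) = z" using two_power_xor_eq_add[OF e] J by simp
    ultimately show "y \<in> ?f ` ?A"
      by (intro image_eqI[of _ _ "(J, z - 2 ^ J)"]) (auto simp: z_def)
  qed
  have "inj_on ?f ?A"
    by (rule eq_card_imp_inj_on) (auto simp: surj card)
  with surj show ?thesis by (simp add: bij_betw_def)
qed

section \<open>The coupling\<close>

definition pendings :: "(nat \<Rightarrow> nat) set" where
  "pendings = PiE {..d} (\<lambda>J. {..<2 ^ J})"

definition labellings :: "(nat \<Rightarrow> nat) set" where
  "labellings = {\<sigma>. \<sigma> permutes {..<N}}"

text \<open>A state consists of the position of the walker labelled 0, the pending jumps, and the
  assignment of vertices to positions.\<close>

definition states :: "(nat \<times> (nat \<Rightarrow> nat) \<times> (nat \<Rightarrow> nat)) set" where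
  "states = {..<n} \<times> pendings \<times> labellings"

definition moves :: "((nat \<times> nat) \<times> nat) set" where
  "moves = (SIGMA J:{..d}. {..<2 ^ J}) \<times> {..<N - 1}"

fun step :: "(nat \<times> nat) \<times> nat \<Rightarrow> nat \<times> (nat \<Rightarrow> nat) \<times> (nat \<Rightarrow> nat)
    \<Rightarrow> nat \<times> (nat \<Rightarrow> nat) \<times> (nat \<Rightarrow> nat)" where
  "step ((J, r), c) (g, E, \<sigma>)
    = (g XOR (2 ^ J XOR E J), E(J := E J XOR r), \<sigma> \<circ> relabel N n c)"

fun vertex :: "nat \<Rightarrow> nat \<times> (nat \<Rightarrow> nat) \<times> (nat \<Rightarrow> nat) \<Rightarrow> nat" where
  "vertex a (g, E, \<sigma>) = Suc (\<sigma> (g XOR offset E a d))"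

lemma n_ge_2: "2 \<le> n" and N_ge_2: "2 \<le> N"
proof -
  have "(2 :: nat) ^ 1 \<le> 2 ^ Suc d" by (rule power_increasing) auto
  then show "2 \<le> n" using n by simp
  then show "2 \<le> N" using nN by simp
qed

lemma pendings_less: "E \<in> pendings \<Longrightarrow> J \<le> d \<Longrightarrow> E J < 2 ^ J"
  by (auto simp: pendings_def)

lemma pendings_update: "E \<in> pendings \<Longrightarrow> J \<le> d \<Longrightarrow> x < 2 ^ J \<Longrightarrow> E(J := x) \<in> pendings"
  unfolding pendings_def by (auto simp: PiE_iff extensional_def)

lemma finite_pendings: "finite pendings"
  unfolding pendings_def by (rule finite_PiE) auto

lemma finite_labellings: "finite labellings"
  unfolding labellings_def by (rule finite_permutations) simp

lemma labelling_less: "\<sigma> \<in> labellings \<Longrightarrow> y < N \<Longrightarrow> \<sigma> y < N"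
  unfolding labellings_def using permutes_in_image[of \<sigma> "{..<N}" y] by auto

lemma labelling_inj: "\<sigma> \<in> labellings \<Longrightarrow> \<sigma> x = \<sigma> y \<longleftrightarrow> x = y"
  unfolding labellings_def using permutes_inj by (auto dest: injD)

lemma labelling_relabel: "\<sigma> \<in> labellings \<Longrightarrow> \<sigma> \<circ> relabel N n c \<in> labellings"
  unfolding labellings_def using permutes_compose[OF relabel_permutes] by auto

lemma two_power_xor_less_n: "J \<le> d \<Longrightarrow> e < 2 ^ J \<Longrightarrow> 2 ^ J XOR e < n"
proof -
  assume "J \<le> d" "e < 2 ^ J"
  moreover from this have "(2 :: nat) ^ Suc J \<le> 2 ^ Suc d" by (intro power_increasing) auto
  ultimately show ?thesis unfolding n using bit_two_power_xor(2)[of e J] by linarith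
qed

lemma jump_less_n:
  assumes "E \<in> pendings" "J \<le> d" "r < 2 ^ J" shows "jump E r a J < n" "jump E r a J \<noteq> 0"
proof -
  have *: "(if bit a J then E J XOR r else E J) < 2 ^ J"
    using pendings_less[OF assms(1,2)] assms(3) xor_less_two_power by auto
  show "jump E r a J < n" unfolding jump_def using assms(2) * by (rule two_power_xor_less_n)
  show "jump E r a J \<noteq> 0" unfolding jump_def using bit_two_power_xor(1)[OF *] by (metis bit_0_eq bot_apply bot_bool_def)
qed

lemma offset_less_n: "E \<in> pendings \<Longrightarrow> offset E a d < n"
  unfolding n by (rule offset_less) (rule pendings_less)

text \<open>For the analysis of one walker its own position \<open>u\<close> is used as coordinate instead of the
  position of the walker labelled 0. In these coordinates a step moves \<open>u\<close> by \<open>jump\<close>: replacing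
  the pending jump changes the offset of exactly the walkers that use the new one.\<close>

lemma step_position:
  assumes "even a" "J \<le> d"
  shows "step ((J, r), c) (u XOR offset E a d, E, \<sigma>)
    = ((u XOR jump E r a J) XOR offset (E(J := E J XOR r)) a d, E(J := E J XOR r), \<sigma> \<circ> relabel N n c)"
  using assms by (simp add: offset_update jump_def ac_simps del: fun_upd_apply)

lemma step_in_states: "x \<in> moves \<Longrightarrow> s \<in> states \<Longrightarrow> step x s \<in> states"
  by (auto simp: moves_def states_def intro!: xor_less two_power_xor_less_n pendings_update
      pendings_less xor_less_two_power labelling_relabel)

lemma inj_step: "inj (step x)"
proof (rule injI)
  obtain J r c where [simp]: "x = ((J, r), c)" by (cases x) auto
  fix s s' assume eq: "step x s = step x s'"
  obtain g E \<sigma> g' E' \<sigma>' where [simp]: "s = (g, E, \<sigma>)" "s' = (g', E', \<sigma>')" by (cases s, cases s') auto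
  have upd: "E(J := E J XOR r) = E'(J := E' J XOR r)" using eq by simp
  have "E j = E' j" for j
  proof (cases "j = J")
    case True
    have "r XOR E J = r XOR E' J" using fun_cong[OF upd, of J] by (simp add: ac_simps)
    then show ?thesis using True by (simp add: xor_cancel)
  next
    case False
    then show ?thesis using fun_cong[OF upd, of j] by simp
  qed
  then have E: "E = E'" by blast
  have "(2 ^ J XOR E J) XOR g = (2 ^ J XOR E J) XOR g'" using eq E by (simp add: ac_simps)
  then have "g = g'" by (simp only: xor_cancel)
  moreover have "\<sigma> y = \<sigma>' y" for y
  proof -
    have "\<sigma> \<circ> relabel N n c = \<sigma>' \<circ> relabel N n c" using eq by simp
    from fun_cong[OF this, of "relabel N n c y"] show ?thesis by (simp add: relabel_involution)
  qed
  ultimately show "s = s'" using E by auto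
qed

sublocale noise_driven states moves step
proof
  show "finite states" "finite moves"
    by (auto simp: states_def moves_def finite_pendings finite_labellings)
  have "(\<lambda>J\<in>{..d}. 0) \<in> pendings" by (simp add: pendings_def)
  moreover have "id \<in> labellings" by (simp add: labellings_def permutes_id)
  moreover have "0 \<in> {..<n}" using n_ge_2 by simp
  ultimately show "states \<noteq> {}" unfolding states_def by blast
  have "((0, 0), 0) \<in> moves" using N_ge_2 by (auto simp: moves_def)
  then show "moves \<noteq> {}" by blast
  fix x assume x: "x \<in> moves"
  have "inj_on (step x) states" using inj_step by (rule inj_on_subset) simp
  moreover have "step x ` states \<subseteq> states" using step_in_states[OF x] by blast
  ultimately show "bij_betw (step x) states states"
    using endo_inj_surj[OF \<open>finite states\<close>] by (simp add: bij_betw_def)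
qed

lemma card_moves: "card moves = (n - 1) * (N - 1)"
proof -
  have "0 < n" using n_ge_2 by simp
  from bij_betw_same_card[OF bij_jumps[OF this]]
  have "card (SIGMA J:{..d}. {..<(2 :: nat) ^ J}) = n - 1" using \<open>0 < n\<close> by simp
  then show ?thesis by (simp add: moves_def card_cartesian_product)
qed

lemma vertex_range: "s \<in> states \<Longrightarrow> vertex a s \<in> {1..N}"
proof -
  assume "s \<in> states"
  then obtain g E \<sigma> where s: "s = (g, E, \<sigma>)" "g < n" "E \<in> pendings" "\<sigma> \<in> labellings"
    by (auto simp: states_def)
  have "g XOR offset E a d < N"
    using xor_less[OF s(2) offset_less_n[OF s(3)]] nN(1) by (rule less_le_trans)
  then show ?thesis using labelling_less[OF s(4)] s(1) by (simp add: Suc_leI)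
qed

text \<open>Relabelling cannot cause a collision, because it either fixes the new position of the moving
  walker or turns it into a position not below \<open>n\<close>, where no walker was before. So it suffices to
  compare positions. The case \<open>b = a\<close> is the absence of loops, the case \<open>a < b\<close> is avoidance.\<close>

lemma vertex_step_neq:
  assumes s: "s \<in> states" and x: "x \<in> moves" and a: "even a"
    and avoid: "\<And>E J r. E \<in> pendings \<Longrightarrow> J \<le> d \<Longrightarrow> r < 2 ^ J \<Longrightarrow> offset E a d XOR jump E r a J \<noteq> offset E b d"
  shows "vertex a (step x s) \<noteq> vertex b s"
proof -
  obtain g E \<sigma> where s: "s = (g, E, \<sigma>)" "g < n" "E \<in> pendings" "\<sigma> \<in> labellings"
    using s by (auto simp: states_def)
  obtain J r c where x: "x = ((J, r), c)" "J \<le> d" "r < 2 ^ J"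
    using x by (auto simp: moves_def)
  define u where "u = g XOR offset E a d"
  have g: "g = u XOR offset E a d" by (simp add: u_def xor.assoc)
  have "u < n" unfolding u_def using xor_less s(2) offset_less_n[OF s(3)] by blast
  then have y: "u XOR jump E r a J < n" using xor_less jump_less_n[OF s(3) x(2,3)] by blast
  have "g XOR offset E b d < n" using xor_less s(2) offset_less_n[OF s(3)] by blast
  moreover have "u XOR jump E r a J \<noteq> g XOR offset E b d"
    using avoid[OF s(3) x(2,3)] by (simp add: u_def xor.assoc xor_cancel)
  ultimately have "relabel N n c (u XOR jump E r a J) \<noteq> g XOR offset E b d"
    using relabel_fixes_low[OF y] by metis
  moreover have "vertex a (step x s) = Suc (\<sigma> (relabel N n c (u XOR jump E r a J)))"
    unfolding s(1) x(1) g step_position[OF a x(2)] by (simp add: xor.assoc)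
  ultimately show ?thesis using labelling_inj[OF s(4)] s(1) by simp
qed

lemma vertex_step_moves:
  assumes "s \<in> states" "x \<in> moves" "even a" shows "vertex a (step x s) \<noteq> vertex a s"
proof (rule vertex_step_neq[OF assms])
  fix E J r assume "E \<in> pendings" "J \<le> d" "r < (2 :: nat) ^ J"
  then show "offset E a d XOR jump E r a J \<noteq> offset E a d"
    using jump_less_n(2) xor_cancel[of "offset E a d" _ 0] by simp
qed

lemma vertex_step_avoids:
  assumes "s \<in> states" "x \<in> moves" "even a" "even b" "a < b" "b < n"
  shows "vertex a (step x s) \<noteq> vertex b s"
proof (rule vertex_step_neq[OF assms(1-3)])
  fix E J r assume "E \<in> pendings" "J \<le> d" "r < (2 :: nat) ^ J"
  then show "offset E a d XOR jump E r a J \<noteq> offset E b d"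
    using offset_avoids(2)[of d E a b J r] pendings_less assms(3-) n by auto
qed

lemma vertex_distinct:
  assumes "s \<in> states" "even a" "even b" "a < b" "b < n"
  shows "vertex a s \<noteq> vertex b s"
proof -
  obtain g E \<sigma> where s: "s = (g, E, \<sigma>)" "E \<in> pendings" "\<sigma> \<in> labellings"
    using assms(1) by (auto simp: states_def)
  have "offset E a d \<noteq> offset E b d"
    using offset_avoids(1)[of d E a b] pendings_less[OF s(2)] assms(2-) n by auto
  then show ?thesis using s labelling_inj by (simp add: xor_cancel)
qed

section \<open>Each walker performs a simple random walk\<close>

text \<open>The first component is written in the coordinates of \<open>step_position\<close>, so that \<open>u\<close> is the
  position of the walker labelled \<open>a\<close> itself.\<close>

definition path_count :: "nat \<Rightarrow> nat \<Rightarrow> (nat \<Rightarrow> nat) \<Rightarrow> (nat \<Rightarrow> nat) \<Rightarrow> nat list \<Rightarrow> nat" where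
  "path_count a u E \<sigma> ws = card (noise_words ws (vertex a) (u XOR offset E a d, E, \<sigma>))"

text \<open>The sum runs over the new pending jump \<open>e\<close> in place of the noise \<open>r\<close> that produces it from
  the old one, so that \<open>e\<close> is visibly free of \<open>E J\<close>.\<close>

lemma path_count_Cons:
  fixes u :: nat
  assumes a: "even a" and E: "E \<in> pendings"
  defines "target \<equiv> \<lambda>J e. u XOR (2 ^ J XOR (if bit a J then e else E J))"
  shows "path_count a u E \<sigma> (w # ws)
    = (\<Sum>J\<le>d. \<Sum>e<2 ^ J. \<Sum>c<N - 1. if Suc (\<sigma> (relabel N n c (target J e))) = w
        then path_count a (target J e) (E(J := e)) (\<sigma> \<circ> relabel N n c) ws else 0)"
proof -
  let ?h = "\<lambda>J e c. if Suc (\<sigma> (relabel N n c (target J e))) = w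
        then path_count a (target J e) (E(J := e)) (\<sigma> \<circ> relabel N n c) ws else 0"
  let ?s = "(u XOR offset E a d, E, \<sigma>)"
  have "path_count a u E \<sigma> (w # ws) = (\<Sum>x\<in>moves. if vertex a (step x ?s) = w
      then card (noise_words ws (vertex a) (step x ?s)) else 0)"
    unfolding path_count_def by (rule card_noise_words_Cons)
  also have "\<dots> = (\<Sum>((J, r), c)\<in>moves. ?h J (E J XOR r) c)"
  proof (rule sum.cong[OF refl])
    fix x assume "x \<in> moves"
    then obtain J r c where x: "x = ((J, r), c)" "J \<le> d" by (auto simp: moves_def)
    have "target J (E J XOR r) = u XOR jump E r a J" by (simp add: target_def jump_def)
    then show "(if vertex a (step x ?s) = w then card (noise_words ws (vertex a) (step x ?s)) else 0)
        = (\<lambda>((J, r), c). ?h J (E J XOR r) c) x"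
      unfolding x(1) step_position[OF a x(2)] by (simp add: path_count_def xor.assoc del: fun_upd_apply)
  qed
  also have "\<dots> = (\<Sum>J\<le>d. \<Sum>r<2 ^ J. \<Sum>c<N - 1. ?h J (E J XOR r) c)"
  proof -
    have "(\<Sum>((J, r), c)\<in>moves. ?h J (E J XOR r) c)
        = (\<Sum>(J, r)\<in>(SIGMA J:{..d}. {..<2 ^ J}). \<Sum>c<N - 1. ?h J (E J XOR r) c)"
      by (simp add: moves_def sum.cartesian_product split_def)
    also have "\<dots> = (\<Sum>J\<le>d. \<Sum>r<2 ^ J. \<Sum>c<N - 1. ?h J (E J XOR r) c)"
      by (subst sum.Sigma) auto
    finally show ?thesis .
  qed
  also have "\<dots> = (\<Sum>J\<le>d. \<Sum>e<2 ^ J. \<Sum>c<N - 1. ?h J e c)"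
  proof (rule sum.cong[OF refl])
    fix J assume "J \<in> {..d}"
    then have EJ: "E J < 2 ^ J" using pendings_less[OF E] by simp
    show "(\<Sum>r<2 ^ J. \<Sum>c<N - 1. ?h J (E J XOR r) c) = (\<Sum>e<2 ^ J. \<Sum>c<N - 1. ?h J e c)"
      by (rule sum.reindex_bij_witness[where i = "\<lambda>e. E J XOR e" and j = "\<lambda>r. E J XOR r"])
         (use EJ in \<open>auto intro: xor_less_two_power\<close>)
  qed
  finally show ?thesis .
qed

text \<open>A walker with bit \<open>J\<close> set never uses the present pending jump of level \<open>J\<close>, only future
  ones, which are uniform whatever the present one is.\<close>

lemma path_count_update:
  assumes a: "even a" and "E \<in> pendings" "J \<le> d" "x < 2 ^ J" "bit a J"
  shows "path_count a u (E(J := x)) \<sigma> ws = path_count a u E \<sigma> ws"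
  using assms(2-)
proof (induction ws arbitrary: u E \<sigma>)
  case Nil
  then show ?case by (simp add: path_count_def)
next
  case (Cons w ws)
  let ?E = "E(J := x)"
  have E': "?E \<in> pendings" using Cons.prems by (intro pendings_update)
  have target: "(if bit a J' then e else ?E J') = (if bit a J' then e else E J')" for J' e
    using \<open>bit a J\<close> by auto
  have IH: "path_count a y (?E(J' := e)) \<tau> ws = path_count a y (E(J' := e)) \<tau> ws"
    if "J' \<le> d" "e < 2 ^ J'" for J' e y \<tau>
  proof (cases "J' = J")
    case False
    then have "?E(J' := e) = (E(J' := e))(J := x)" by (intro fun_upd_twist) simp
    then show ?thesis using Cons that by (simp add: pendings_update del: fun_upd_apply)
  qed simp
  show ?case
    unfolding path_count_Cons[OF a E'] path_count_Cons[OF a Cons.prems(1)] target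
    by (intro sum.cong refl if_cong IH) auto
qed

text \<open>The old and the new pending jump of a level are exchangeable.\<close>

lemma sum_pendings_swap:
  assumes "J \<le> d"
  shows "(\<Sum>E\<in>pendings. \<Sum>e<2 ^ J. f (E J) (E(J := e))) = (\<Sum>E\<in>pendings. \<Sum>e<2 ^ J. f e E)"
  unfolding sum.cartesian_product
  by (rule sum.reindex_bij_witness[where i = "\<lambda>(E, e). (E(J := e), E J)" and j = "\<lambda>(E, e). (E(J := e), E J)"])
     (use assms pendings_less pendings_update in \<open>auto simp del: fun_upd_apply simp: fun_upd_same\<close>)

text \<open>Summed over the pending jumps, the count is multiplied by \<open>n - 1\<close> with every step, whatever the label. A walker with bit \<open>J\<close> unset jumps by
  the old pending jump and keeps the new one for the future; exchanging the two makes the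
  jump fresh. A walker with bit \<open>J\<close> set jumps by the new one, and afterwards its count no longer
  depends on which jump is pending. In both cases the jump is uniform and independent of the
  pending jumps left behind, so that the induction hypothesis applies to them.\<close>

lemma sum_path_count:
  assumes a: "even a" and "u < n" "\<sigma> \<in> labellings" "distinct_adj (Suc (\<sigma> u) # ws)" "set ws \<subseteq> {1..N}"
  shows "(\<Sum>E\<in>pendings. path_count a u E \<sigma> ws) = card pendings * (n - 1) ^ length ws"
  using assms(2-)
proof (induction ws arbitrary: u \<sigma>)
  case Nil
  then show ?case by (simp add: path_count_def)
next
  case (Cons w ws)
  note u = \<open>u < n\<close> and \<sigma> = \<open>\<sigma> \<in> labellings\<close>
  define T where "T y E c = (if Suc (\<sigma> (relabel N n c y)) = w
    then path_count a y E (\<sigma> \<circ> relabel N n c) ws else 0)" for y E c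
  define const where "const = card pendings * (n - 1) ^ length ws"
  have "(\<Sum>E\<in>pendings. path_count a u E \<sigma> (w # ws))
      = (\<Sum>E\<in>pendings. \<Sum>J\<le>d. \<Sum>e<2 ^ J. \<Sum>c<N - 1.
          T (u XOR (2 ^ J XOR (if bit a J then e else E J))) (E(J := e)) c)"
    by (intro sum.cong refl) (simp add: path_count_Cons[OF a] T_def del: fun_upd_apply)
  also have "\<dots> = (\<Sum>J\<le>d. \<Sum>E\<in>pendings. \<Sum>e<2 ^ J. \<Sum>c<N - 1.
          T (u XOR (2 ^ J XOR (if bit a J then e else E J))) (E(J := e)) c)"
    by (rule sum.swap)
  also have "\<dots> = (\<Sum>J\<le>d. \<Sum>E\<in>pendings. \<Sum>e<2 ^ J. \<Sum>c<N - 1. T (u XOR (2 ^ J XOR e)) E c)"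
  proof (rule sum.cong[OF refl])
    fix J assume "J \<in> {..d}"
    then have J: "J \<le> d" by simp
    show "(\<Sum>E\<in>pendings. \<Sum>e<2 ^ J. \<Sum>c<N - 1.
          T (u XOR (2 ^ J XOR (if bit a J then e else E J))) (E(J := e)) c)
        = (\<Sum>E\<in>pendings. \<Sum>e<2 ^ J. \<Sum>c<N - 1. T (u XOR (2 ^ J XOR e)) E c)"
    proof (cases "bit a J")
      case True
      then show ?thesis using J
        by (intro sum.cong refl) (auto simp: T_def path_count_update[OF a] simp del: fun_upd_apply)
    next
      case False
      then show ?thesis
        using sum_pendings_swap[OF J, of "\<lambda>e E. \<Sum>c<N - 1. T (u XOR (2 ^ J XOR e)) E c"] by simp
    qed
  qed
  also have "\<dots> = (\<Sum>J\<le>d. \<Sum>e<2 ^ J. \<Sum>E\<in>pendings. \<Sum>c<N - 1. T (u XOR (2 ^ J XOR e)) E c)"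
    by (intro sum.cong refl sum.swap)
  also have "\<dots> = (\<Sum>(J, e)\<in>(SIGMA J:{..d}. {..<2 ^ J}). \<Sum>E\<in>pendings. \<Sum>c<N - 1. T (u XOR (2 ^ J XOR e)) E c)"
    by (simp add: sum.Sigma)
  \<comment> \<open>Levels and jumps are combined into a new position that is uniform among all others.\<close>
  also have "\<dots> = (\<Sum>y\<in>{..<n} - {u}. \<Sum>E\<in>pendings. \<Sum>c<N - 1. T y E c)"
    using sum.reindex_bij_betw[OF bij_jumps[OF u], of "\<lambda>y. \<Sum>E\<in>pendings. \<Sum>c<N - 1. T y E c"]
    by (simp add: split_def)
  also have "\<dots> = (\<Sum>y\<in>{..<n} - {u}. \<Sum>c<N - 1. \<Sum>E\<in>pendings. T y E c)"
    by (intro sum.cong refl sum.swap)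
  also have "\<dots> = (\<Sum>y\<in>{..<n} - {u}. \<Sum>c<N - 1. if Suc (\<sigma> (relabel N n c y)) = w then const else 0)"
  proof (intro sum.cong refl)
    fix y c assume y: "y \<in> {..<n} - {u}"
    show "(\<Sum>E\<in>pendings. T y E c) = (if Suc (\<sigma> (relabel N n c y)) = w then const else 0)"
    proof (cases "Suc (\<sigma> (relabel N n c y)) = w")
      case True
      then have "(\<Sum>E\<in>pendings. path_count a y E (\<sigma> \<circ> relabel N n c) ws) = const"
        unfolding const_def using y Cons.prems by (intro Cons.IH labelling_relabel) auto
      then show ?thesis using True by (simp add: T_def)
    qed (simp add: T_def)
  qed
  also have "\<dots> = (\<Sum>(y, c)\<in>({..<n} - {u}) \<times> {..<N - 1}. if Suc (\<sigma> (relabel N n c y)) = w then const else 0)"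
    by (rule sum.cartesian_product)
  also have "\<dots> = (\<Sum>x\<in>{x \<in> ({..<n} - {u}) \<times> {..<N - 1}. Suc (\<sigma> (relabel N n (snd x) (fst x))) = w}. const)"
    by (subst sum.inter_filter) (auto simp: split_def)
  also have "\<dots> = (n - 1) * const"
  proof -
    obtain v where v: "\<sigma> v = w - 1" "v < N"
    proof -
      have "w - 1 \<in> \<sigma> ` {..<N}"
        using Cons.prems(4) permutes_image[of \<sigma> "{..<N}"] \<sigma> by (auto simp: labellings_def)
      then show ?thesis using that by auto
    qed
    have w: "Suc (\<sigma> y) = w \<longleftrightarrow> y = v" for y
      using labelling_inj[OF \<sigma>, of y v] v(1) Cons.prems(4) by auto
    have "v \<noteq> u" using w[of u] Cons.prems(3) by auto
    have "{x \<in> ({..<n} - {u}) \<times> {..<N - 1}. Suc (\<sigma> (relabel N n (snd x) (fst x))) = w}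
        = {(y, c). y < n \<and> y \<noteq> u \<and> c < N - 1 \<and> relabel N n c y = v}" by (auto simp: w)
    then show ?thesis using card_relabel_to[OF u v(2) \<open>v \<noteq> u\<close>] by simp
  qed
  finally show ?case by (simp add: const_def)
qed

lemma path_counts_geometric:
  assumes a: "even a" and "w \<in> {1..N}" "set ws \<subseteq> {1..N}" "distinct_adj (w # ws)"
  shows "(\<Sum>s | s \<in> states \<and> vertex a s = w. card (noise_words ws (vertex a) s))
    = (\<Sum>\<sigma>\<in>labellings. \<Sum>u<n. if Suc (\<sigma> u) = w then card pendings else 0) * (n - 1) ^ length ws"
proof -
  let ?f = "\<lambda>s. if vertex a s = w then card (noise_words ws (vertex a) s) else 0"
  have "(\<Sum>s | s \<in> states \<and> vertex a s = w. card (noise_words ws (vertex a) s)) = (\<Sum>s\<in>states. ?f s)"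
    using sum.inter_filter[OF fin_S, of "\<lambda>s. card (noise_words ws (vertex a) s)" "\<lambda>s. vertex a s = w"] by simp
  also have "\<dots> = (\<Sum>g<n. \<Sum>E\<in>pendings. \<Sum>\<sigma>\<in>labellings. ?f (g, E, \<sigma>))"
    unfolding states_def sum.cartesian_product by (rule sum.cong) (auto simp del: vertex.simps)
  also have "\<dots> = (\<Sum>\<sigma>\<in>labellings. \<Sum>E\<in>pendings. \<Sum>g<n. ?f (g, E, \<sigma>))"
    by (subst sum.swap, subst (2) sum.swap, subst sum.swap) (rule refl)
  also have "\<dots> = (\<Sum>\<sigma>\<in>labellings. \<Sum>E\<in>pendings. \<Sum>u<n. if Suc (\<sigma> u) = w then path_count a u E \<sigma> ws else 0)"
  proof (rule sum.cong[OF refl], rule sum.cong[OF refl])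
    fix \<sigma> E assume "E \<in> pendings"
    then have off: "offset E a d < n" by (rule offset_less_n)
    show "(\<Sum>g<n. ?f (g, E, \<sigma>)) = (\<Sum>u<n. if Suc (\<sigma> u) = w then path_count a u E \<sigma> ws else 0)"
      by (rule sum.reindex_bij_witness[where i = "\<lambda>u. u XOR offset E a d" and j = "\<lambda>g. g XOR offset E a d"])
         (use off in \<open>auto simp: path_count_def xor.assoc intro: xor_less\<close>)
  qed
  also have "\<dots> = (\<Sum>\<sigma>\<in>labellings. \<Sum>u<n. \<Sum>E\<in>pendings. if Suc (\<sigma> u) = w then path_count a u E \<sigma> ws else 0)"
    by (intro sum.cong refl sum.swap)
  also have "\<dots> = (\<Sum>\<sigma>\<in>labellings. \<Sum>u<n. (if Suc (\<sigma> u) = w then card pendings else 0) * (n - 1) ^ length ws)"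
    using assms by (intro sum.cong refl) (auto simp: sum_path_count)
  finally show ?thesis by (simp add: sum_distrib_right)
qed

section \<open>Existence of the coupling\<close>

text \<open>The doubling of the walkers' numbers \<open>i - 1\<close> keeps level 0 out of the labels, as the XOR with
  1 in the offsets requires.\<close>

lemma simple_avoidance_coupling_sample:
  assumes "k \<le> 2 ^ d"
  shows "simple_avoidance_coupling sample N (complete_graph N) k
    (\<lambda>t \<omega> i. vertex (2 * (i - 1)) (state t \<omega>))"
  unfolding simple_avoidance_coupling_def
proof (intro conjI ballI allI impI)
  show "prob_space sample" by unfold_locales
  show "simple_graph N (complete_graph N)" by (simp add: simple_graph_def)
  show "simple_random_walk sample N (complete_graph N) (\<lambda>t \<omega>. vertex (2 * (i - 1)) (state t \<omega>))" for i
    by (rule walk_if_path_counts_geometric[OF vertex_range vertex_step_moves path_counts_geometric card_moves]) auto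
next
  fix t :: int and i j :: nat
  assume ij: "1 \<le> i \<and> i < j \<and> j \<le> k"
  let ?a = "2 * (i - 1)" and ?b = "2 * (j - 1)"
  have ab: "even ?a" "even ?b" "?a < ?b" "?b < n"
    using ij assms unfolding n by auto
  have "vertex ?a (state t \<omega>) \<noteq> vertex ?b (state t \<omega>)" if "\<omega> \<in> space sample" for \<omega>
    using vertex_distinct[OF state_in_S[OF that] ab] .
  then have "{\<omega>\<in>space sample. vertex ?a (state t \<omega>) = vertex ?b (state t \<omega>)} = {}" by blast
  then show "\<P>(\<omega> in sample. vertex ?a (state t \<omega>) = vertex ?b (state t \<omega>)) = 0"
    by (simp only: measure_empty)
  have "vertex ?a (state t \<omega>) \<noteq> vertex ?b (state (t - 1) \<omega>)" if \<omega>: "\<omega> \<in> space sample" for \<omega>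
  proof -
    have "snd \<omega> (t - 1) \<in> moves" using \<omega> by (auto simp: space_sample)
    from vertex_step_avoids[OF state_in_S[OF \<omega>] this ab] show ?thesis
      using state_step[OF \<omega>, of "t - 1"] by simp
  qed
  then have "{\<omega>\<in>space sample. vertex ?a (state t \<omega>) = vertex ?b (state (t - 1) \<omega>)} = {}" by blast
  then show "\<P>(\<omega> in sample. vertex ?a (state t \<omega>) = vertex ?b (state (t - 1) \<omega>)) = 0"
    by (simp only: measure_empty)
qed

end

theorem theorem2:
  fixes N :: nat
  assumes "N \<ge> 2"
  shows "\<exists>(M :: (int \<Rightarrow> nat \<Rightarrow> nat) measure) (U :: int \<Rightarrow> (int \<Rightarrow> nat \<Rightarrow> nat) \<Rightarrow> nat \<Rightarrow> nat).
           simple_avoidance_coupling M N (complete_graph N) (nat \<lceil>real N / 4\<rceil>) U"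
proof -
  obtain e where e: "2 ^ e \<le> N" "N < 2 ^ (e + 1)"
    using ex_power_ivl1[of 2 N] assms by auto
  have "e \<noteq> 0" using e(2) assms by (cases e) auto
  then obtain d where d: "e = Suc d" by (cases e) auto
  interpret xor_coupling d "2 ^ Suc d" N
    by unfold_locales (use e d in auto)
  have "real N < real (4 * 2 ^ d)" using e(2) unfolding d of_nat_less_iff by simp
  then have "nat \<lceil>real N / 4\<rceil> \<le> 2 ^ d" by (simp add: nat_le_iff ceiling_le_iff)
  from simple_avoidance_coupling_on_trajectories[OF simple_avoidance_coupling_sample[OF this]]
  show ?thesis .
qed

end
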